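(* Let $A,B,C,D,E\in\mathbb{R}^4$ be the vertices of a regular $4$-dimensional simplex with side length $1$, and let $\mathcal{R}=\bigcap_{X\in\{A,B,C,D,E\}}\mathcal{B}(X,1)$ be the unit $4$-dimensional Reuleaux simplex with these vertices. Then there exists a set $\mathcal{M}_0$ with $\{A,B,C,D,E\}\subset\mathcal{M}_0$, contained in the $2$-skeleton of $\mathcal{R}$ (which is formed by parts of $2$-dimensional spheres), such that, setting $$\mathcal{M}=\bigcap_{P\in\mathcal{M}_0}\mathcal{B}(P,1),$$ the following hold: (1) $\mathcal{M}$ is a body of constant width. (2) $\mathcal{M}_0$, and therefore $\mathcal{M}$, is mapped onto itself by every isometry of $\mathbb{R}^4$ that fixes $E$ and permutes $A,B,C,D$. (3) $\mathcal{M}_0$ is contained in the boundary $\partial\mathcal{M}$ of $\mathcal{M}$. (4) Every point of $\partial\mathcal{M}\setminus\mathcal{M}_0$ is a smooth point of $\partial\mathcal{M}$. (5) Every diameter of $\mathcal{M}$ has at least one endpoint in $\mathcal{M}_0$.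
   Context: $\mathcal{B}(x,r)$ denotes the closed ball of radius $r$ centered at $x$ in $\mathbb{R}^4$. A convex body in $\mathbb{R}^n$ (compact convex set with nonempty interior) has constant width if the distance between its two parallel supporting hyperplanes is the same in all directions. The $2$-skeleton of $\mathcal{R}$ is the union of its $2$-dimensional faces. For three distinct vertices $X,Y,Z\in\{A,B,C,D,E\}$, with $V,W$ the remaining two vertices, the $2$-dimensional face $F_{X,Y,Z}$ of $\mathcal{R}$ is the set of points of $\mathcal{R}$ at distance exactly $1$ from both $V$ and $W$; it is part of a $2$-dimensional sphere of radius $\sqrt{3}/2$ centered at the midpoint of $V$ and $W$. A point of the boundary of a convex body is smooth if the body has exactly one supporting hyperplane at that point. A diameter of $\mathcal{M}$ is a segment with both endpoints in $\mathcal{M}$ whose length equals the maximum distance between two points of $\mathcal{M}$. *)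

theory Defs
  imports "HOL-Analysis.Analysis"
begin

definition regular_simplex_vertices :: "nat \<Rightarrow> real \<Rightarrow> 'a::euclidean_space set \<Rightarrow> bool" where
  "regular_simplex_vertices n s V \<longleftrightarrow>
     card V = n + 1 \<and> \<not> affine_dependent V \<and> (\<forall>X\<in>V. \<forall>Y\<in>V. X \<noteq> Y \<longrightarrow> dist X Y = s)"

definition unit_ball_inter :: "'a::euclidean_space set \<Rightarrow> 'a set" where
  "unit_ball_inter S = (\<Inter>P\<in>S. cball P 1)"

text \<open>
  For \<open>V\<close> the five vertices in dimension 4 and \<open>T = {X, Y, Z}\<close>, this is the
  2-dimensional face \<open>F\<^sub>X\<^sub>Y\<^sub>Z\<close>: the points of the Reuleaux simplex at distance 1 from the
  two vertices not in \<open>T\<close>.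
\<close>
definition reuleaux_face :: "'a::euclidean_space set \<Rightarrow> 'a set \<Rightarrow> 'a set" where
  "reuleaux_face V T = {p \<in> unit_ball_inter V. \<forall>W \<in> V - T. dist p W = 1}"

definition two_skeleton :: "'a::euclidean_space set \<Rightarrow> 'a set" where
  "two_skeleton V = \<Union> {reuleaux_face V T | T. T \<subseteq> V \<and> card T = 3}"

definition convex_body :: "'a::euclidean_space set \<Rightarrow> bool" where
  "convex_body K \<longleftrightarrow> compact K \<and> convex K \<and> interior K \<noteq> {}"

definition supporting_hyperplane :: "'a::euclidean_space set \<Rightarrow> 'a set \<Rightarrow> bool" where
  "supporting_hyperplane K H \<longleftrightarrow>
     (\<exists>u c. u \<noteq> 0 \<and> H = {x. u \<bullet> x = c} \<and> K \<subseteq> {x. u \<bullet> x \<le> c} \<and> K \<inter> H \<noteq> {})"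

text \<open>
  A convex body has exactly two distinct supporting hyperplanes orthogonal to a given
  \<open>u \<noteq> 0\<close>; \<open>setdist\<close> is the distance between them.
\<close>
definition constant_width_body :: "'a::euclidean_space set \<Rightarrow> bool" where
  "constant_width_body K \<longleftrightarrow> convex_body K \<and>
     (\<exists>w. \<forall>u c c'. u \<noteq> 0 \<and> c \<noteq> c' \<and>
        supporting_hyperplane K {x. u \<bullet> x = c} \<and> supporting_hyperplane K {x. u \<bullet> x = c'} \<longrightarrow>
        setdist {x. u \<bullet> x = c} {x. u \<bullet> x = c'} = w)"

definition smooth_point :: "'a::euclidean_space set \<Rightarrow> 'a \<Rightarrow> bool" where
  "smooth_point K x \<longleftrightarrow> x \<in> frontier K \<and> (\<exists>!H. supporting_hyperplane K H \<and> x \<in> H)"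

definition euclidean_isometry :: "('a::euclidean_space \<Rightarrow> 'a) \<Rightarrow> bool" where
  "euclidean_isometry f \<longleftrightarrow> (\<forall>x y. dist (f x) (f y) = dist x y)"

text \<open>The endpoints of a diameter of \<open>K\<close>; \<open>diameter K\<close> is attained when \<open>K\<close> is compact.\<close>
definition diameter_endpoints :: "'a::euclidean_space set \<Rightarrow> 'a \<Rightarrow> 'a \<Rightarrow> bool" where
  "diameter_endpoints K p q \<longleftrightarrow> p \<in> K \<and> q \<in> K \<and> dist p q = diameter K"

end

theory Submission
  imports Defs
begin

text \<open>
  Let \<open>M0\<close> consist of the points of the six faces through \<open>E\<close> that are not inside a certain sphere with
  centre on the axis through \<open>E\<close>. In suitable coordinates this sphere is the unit sphere, the vertices
  \<open>A\<close>, \<open>B\<close>, \<open>C\<close>, \<open>D\<close> are the standard basis and \<open>M0\<close> is bounded by the quarter circles in the coordinate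
  planes. Everything rests on one fact: two points of \<open>M\<close> at maximal distance cannot both lie
  outside \<open>M0\<close>. For two points outside the unit ball this is an inequality between nonnegative
  quantities; a point of \<open>M\<close> inside the unit ball has a small negative part, because of the quarter
  circles; and a farthest point outside the unit ball that is not in \<open>M0\<close> could be moved farther away.

  The maximal distance is therefore \<open>1\<close>, so \<open>M\<close> is the intersection of the unit balls with
  centres in \<open>M\<close>, which gives constant width. At a nonsmooth boundary point outside \<open>M0\<close>, the opposite
  points would contain an arc of a unit circle in \<open>M0\<close>, but \<open>M0\<close> is covered by unit spheres about
  the vertices.
\<close>

section \<open>Intersections of unit balls\<close>

lemma mem_unit_ball_inter: "x \<in> unit_ball_inter S \<longleftrightarrow> (\<forall>P\<in>S. dist P x \<le> 1)"
  by (auto simp: unit_ball_inter_def)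

text \<open>Taking ball intersections reverses inclusions, so the first assumption gives one
  inclusion; the distance bound gives the other. Constant width is drawn from this
  self-duality.\<close>

lemma unit_ball_inter_self_dual:
  assumes "S \<subseteq> unit_ball_inter S"
    and "\<And>x y. x \<in> unit_ball_inter S \<Longrightarrow> y \<in> unit_ball_inter S \<Longrightarrow> dist x y \<le> 1"
  shows "unit_ball_inter (unit_ball_inter S) = unit_ball_inter S"
  using assms by (auto simp: mem_unit_ball_inter subset_iff)

lemma unit_ball_inter_image:
  assumes "surj f" and "\<And>x y. dist (f x) (f y) = dist x y"
  shows "f ` unit_ball_inter S = unit_ball_inter (f ` S)"
proof (intro set_eqI iffI)
  fix z assume z: "z \<in> unit_ball_inter (f ` S)"
  obtain x where x: "z = f x" using assms(1) by (metis surjD)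
  with z assms(2) have "x \<in> unit_ball_inter S" by (auto simp: mem_unit_ball_inter)
  with x show "z \<in> f ` unit_ball_inter S" by blast
qed (auto simp: mem_unit_ball_inter assms(2))

text \<open>The isometries in the theorem are given by preservation of distances alone; in finite
  dimension the translate fixing \<open>0\<close> is orthogonal, hence onto.\<close>

lemma dist_isometry_imp_surj:
  fixes f :: "'a::euclidean_space \<Rightarrow> 'a"
  assumes "\<And>x y. dist (f x) (f y) = dist x y"
  shows "surj f"
proof -
  have "orthogonal_transformation (\<lambda>x. f x - f 0)"
    unfolding orthogonal_transformation_isometry using assms by (simp add: dist_norm)
  then have "surj (\<lambda>x. f x - f 0)" by (rule orthogonal_transformation_surj)
  then have "\<exists>x. f x = y" for y using surjD[of "\<lambda>x. f x - f 0" "y - f 0"] by force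
  then show ?thesis by (metis surjI surj_def)
qed

section \<open>Convexity, interior and constant width\<close>

lemma convex_unit_ball_inter: "convex (unit_ball_inter S)"
  by (auto simp: unit_ball_inter_def intro!: convex_INT)

lemma compact_unit_ball_inter: "S \<noteq> {} \<Longrightarrow> compact (unit_ball_inter S)"
  unfolding unit_ball_inter_def by (rule compact_Inter) auto

lemma norm_add_sq: "(norm (a + b))\<^sup>2 = (norm a)\<^sup>2 + 2 * (a \<bullet> b) + (norm (b::'a::real_inner))\<^sup>2"
  by (simp add: power2_norm_eq_inner inner_add inner_commute)

lemma norm_add_scaleR_sq:
  "(norm (a + e *\<^sub>R b))\<^sup>2 = (norm a)\<^sup>2 + 2 * e * (a \<bullet> b) + e\<^sup>2 * (norm (b::'a::real_inner))\<^sup>2"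
  by (simp add: norm_add_sq power_mult_distrib)

lemma dist_le_1_iff: "dist x y \<le> 1 \<longleftrightarrow> (norm (x - y))\<^sup>2 \<le> 1"
  by (simp add: dist_norm power_le_one_iff)

text \<open>By the parallelogram law the midpoint of \<open>a\<close> and \<open>b\<close> is within
  \<open>r < 1\<close> of every point of \<open>K\<close>, so a ball of radius \<open>1 - r\<close>
  about it lies in all the unit balls.\<close>

lemma interior_self_dual_nonempty:
  fixes K :: "'a::euclidean_space set"
  assumes K: "unit_ball_inter K = K" and ab: "a \<in> K" "b \<in> K" "a \<noteq> b"
  shows "interior K \<noteq> {}"
proof -
  define m where "m = (1/2) *\<^sub>R (a + b)"
  define r where "r = sqrt (1 - (norm (a - b))\<^sup>2 / 4)"
  have d1: "norm (a - b) \<le> 1" using K ab by (metis mem_unit_ball_inter dist_norm)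
  have d0: "0 < (norm (a - b))\<^sup>2" using ab by simp
  have dd: "(norm (a - b))\<^sup>2 \<le> 1" using d1 by (simp add: power_le_one_iff)
  have r1: "r < 1" unfolding r_def using d0 by (simp add: real_sqrt_lt_1_iff)
  have mp: "norm (m - P) \<le> r" if "P \<in> K" for P
  proof -
    have "norm (a - P) \<le> 1" "norm (b - P) \<le> 1"
      using K ab that by (metis mem_unit_ball_inter dist_norm dist_commute)+
    then have "(norm (a - P))\<^sup>2 \<le> 1" "(norm (b - P))\<^sup>2 \<le> 1" by (simp_all add: power_le_one_iff)
    moreover have "(norm (m - P))\<^sup>2 = ((norm (a - P))\<^sup>2 + (norm (b - P))\<^sup>2) / 2 - (norm (a - b))\<^sup>2 / 4"
      unfolding m_def power2_norm_eq_inner by (simp add: inner_diff inner_add inner_commute field_simps)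
    ultimately have "(norm (m - P))\<^sup>2 \<le> 1 - (norm (a - b))\<^sup>2 / 4" by simp
    then show ?thesis unfolding r_def by (rule real_le_rsqrt)
  qed
  have "ball m (1 - r) \<subseteq> K"
  proof
    fix z assume z: "z \<in> ball m (1 - r)"
    have "dist P z \<le> 1" if "P \<in> K" for P
      using dist_triangle[of P z m] mp[OF that] z by (simp add: dist_norm norm_minus_commute)
    then show "z \<in> K" using K by (metis mem_unit_ball_inter)
  qed
  then have "m \<in> interior K" using r1 by (meson centre_in_ball diff_gt_0_iff_gt interiorI open_ball)
  then show ?thesis by blast
qed

text \<open>If \<open>z \<in> K\<close> were farther than \<open>1\<close> from \<open>x - u\<close>, then \<open>x\<close> could be moved a little
  along the unit arc towards \<open>z\<close> without leaving \<open>K\<close>, and this would increase \<open>u \<bullet> _\<close>.\<close>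
lemma self_dual_opposite_point:
  fixes K :: "'a::euclidean_space set"
  assumes K: "unit_ball_inter K = K" and x: "x \<in> K" and u: "norm u = 1"
    and sup: "\<And>z. z \<in> K \<Longrightarrow> u \<bullet> z \<le> u \<bullet> x"
  shows "x - u \<in> K"
proof -
  have "dist z (x - u) \<le> 1" if z: "z \<in> K" for z
  proof (rule ccontr)
    assume "\<not> dist z (x - u) \<le> 1"
    then have "1 < (norm (z - x + u))\<^sup>2"
      by (simp add: dist_le_1_iff algebra_simps)
    then have zz: "- (u \<bullet> (z - x)) < (norm (z - x))\<^sup>2 / 2"
      using u by (simp add: norm_add_sq inner_commute)
    have nn: "0 \<le> - (u \<bullet> (z - x))" using sup[OF z] by (simp add: inner_diff)
    obtain s where s: "- (u \<bullet> (z - x)) < s" "s < (norm (z - x))\<^sup>2 / 2"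
      using zz dense by blast
    \<comment> \<open>\<open>w\<close> bends the chord direction \<open>z - x\<close> towards
      \<open>u\<close>. The lower bound on \<open>s\<close> makes \<open>u \<bullet> w\<close>
      positive; the upper bound makes the slack \<open>g\<close> positive, which pays for the
      second-order term of a step along \<open>w\<close>.\<close>
    define w where "w = z - x + s *\<^sub>R u"
    define g where "g = (norm (z - x))\<^sup>2 - 2 * s"
    have g: "g > 0" using s by (simp add: g_def)
    define e where "e = min 1 (g / ((norm w)\<^sup>2 + 1))"
    have wp: "(norm w)\<^sup>2 + 1 > 0" by (simp add: add_nonneg_pos)
    have e: "0 < e" "e \<le> 1" using g wp by (simp_all add: e_def)
    have "e * (norm w)\<^sup>2 \<le> e * ((norm w)\<^sup>2 + 1)" using e by simp
    also have "\<dots> \<le> g" using wp unfolding e_def by (simp add: min_le_iff_disj pos_le_divide_eq[symmetric])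
    finally have eg: "e * (norm w)\<^sup>2 \<le> g" .
    have "x + e *\<^sub>R w \<in> K"
    proof -
      have "dist P (x + e *\<^sub>R w) \<le> 1" if P: "P \<in> K" for P
      proof -
        have d: "norm (x - P) \<le> 1" "norm (z - P) \<le> 1"
          using K x z P by (metis mem_unit_ball_inter dist_norm dist_commute)+
        then have d2: "(norm (x - P))\<^sup>2 \<le> 1" "(norm (z - P))\<^sup>2 \<le> 1"
          by (simp_all add: power_le_one_iff)
        have "(norm (z - P))\<^sup>2 = (norm (x - P))\<^sup>2 + 2 * ((x - P) \<bullet> (z - x)) + (norm (z - x))\<^sup>2"
          using norm_add_sq[of "x - P" "z - x"] by simp
        moreover have "(x - P) \<bullet> u \<le> 1"
          using norm_cauchy_schwarz[of "x - P" u] d u by simp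
        then have "s * ((x - P) \<bullet> u) \<le> s * 1" using s nn by (intro mult_left_mono) auto
        ultimately have "2 * ((x - P) \<bullet> w) \<le> 1 - (norm (x - P))\<^sup>2 - g"
          using d2 unfolding w_def g_def by (simp add: inner_add)
        then have "e * (2 * ((x - P) \<bullet> w)) \<le> e * (1 - (norm (x - P))\<^sup>2 - g)"
          using e by (intro mult_left_mono) auto
        moreover have "e * (e * (norm w)\<^sup>2) \<le> e * g" using eg e by (intro mult_left_mono) auto
        moreover have "(1 - e) * (norm (x - P))\<^sup>2 \<le> (1 - e) * 1"
          using d2 e by (intro mult_left_mono) auto
        ultimately have "(norm (x - P + e *\<^sub>R w))\<^sup>2 \<le> 1"
          unfolding norm_add_scaleR_sq by (simp add: power2_eq_square algebra_simps)
        then show ?thesis by (subst dist_commute) (simp add: dist_le_1_iff algebra_simps)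
      qed
      then show ?thesis using K by (metis mem_unit_ball_inter)
    qed
    from sup[OF this] have "e * (u \<bullet> w) \<le> 0" by (simp add: inner_add)
    moreover have "u \<bullet> w > 0"
      using s u by (simp add: w_def inner_add power2_norm_eq_inner[symmetric])
    ultimately show False using e by (simp add: mult_le_0_iff)
  qed
  then show ?thesis using K by (metis mem_unit_ball_inter)
qed

lemma supporting_hyperplane_normalized:
  assumes "supporting_hyperplane K H" "x \<in> H"
  obtains u where "norm u = 1" "H = {z. u \<bullet> z = u \<bullet> x}" "\<And>z. z \<in> K \<Longrightarrow> u \<bullet> z \<le> u \<bullet> x"
proof -
  from assms obtain v c where v: "v \<noteq> 0" and H: "H = {x. v \<bullet> x = c}"
    and K: "K \<subseteq> {x. v \<bullet> x \<le> c}"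
    unfolding supporting_hyperplane_def by blast
  have c: "c = v \<bullet> x" using H assms by auto
  define u where "u = v /\<^sub>R norm v"
  have "norm u = 1" using v by (simp add: u_def)
  moreover have "H = {z. u \<bullet> z = u \<bullet> x}" using v unfolding H c u_def by simp
  moreover have "u \<bullet> z \<le> u \<bullet> x" if "z \<in> K" for z
    using v K that unfolding c u_def by (auto simp: divide_right_mono)
  ultimately show ?thesis by (rule that)
qed

text \<open>All pairs of points are within distance \<open>1\<close>, which bounds the width above;
  the opposite point \<open>x - v\<close> of a touching point \<open>x\<close> shows that the bound
  is attained in every direction.\<close>

lemma constant_width_self_dual:
  fixes K :: "'a::euclidean_space set"
  assumes K: "unit_ball_inter K = K" and ab: "a \<in> K" "b \<in> K" "a \<noteq> b"
  shows "constant_width_body K"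
proof -
  have cb: "convex_body K"
    unfolding convex_body_def
    using interior_self_dual_nonempty[OF K ab] convex_unit_ball_inter[of K]
      compact_unit_ball_inter[of K] K ab by auto
  have touch: "\<exists>v x. norm v = 1 \<and> x \<in> K \<and> {z. u \<bullet> z = c} = {z. v \<bullet> z = v \<bullet> x}
      \<and> (\<forall>z\<in>K. v \<bullet> z \<le> v \<bullet> x) \<and> u \<bullet> x = c"
    if sh: "supporting_hyperplane K {x. u \<bullet> x = c}" for u c
  proof -
    have "\<exists>x. x \<in> K \<and> u \<bullet> x = c"
    proof -
      have "K \<inter> {x. u \<bullet> x = c} \<noteq> {}" using sh unfolding supporting_hyperplane_def by auto
      then show ?thesis by blast
    qed
    then obtain x where x: "x \<in> K" "u \<bullet> x = c" by blast
    then have "x \<in> {x. u \<bullet> x = c}" by simp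
    then obtain v where "norm v = 1" "{z. u \<bullet> z = c} = {z. v \<bullet> z = v \<bullet> x}" "\<And>z. z \<in> K \<Longrightarrow> v \<bullet> z \<le> v \<bullet> x"
      using supporting_hyperplane_normalized[OF sh] by blast
    with x show ?thesis by blast
  qed
  have "setdist {x. u \<bullet> x = c} {x. u \<bullet> x = c'} = 1"
    if ne: "c \<noteq> c'" and h: "supporting_hyperplane K {x. u \<bullet> x = c}"
      and h': "supporting_hyperplane K {x. u \<bullet> x = c'}" for u c c'
  proof -
    from touch[OF h] obtain v x where v: "norm v = 1" and x: "x \<in> K"
      and H: "{z. u \<bullet> z = c} = {z. v \<bullet> z = v \<bullet> x}"
      and sup: "\<And>z. z \<in> K \<Longrightarrow> v \<bullet> z \<le> v \<bullet> x" and ux: "u \<bullet> x = c" by blast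
    from touch[OF h'] obtain v' x' where v': "norm v' = 1" and x': "x' \<in> K"
      and H': "{z. u \<bullet> z = c'} = {z. v' \<bullet> z = v' \<bullet> x'}"
      and sup': "\<And>z. z \<in> K \<Longrightarrow> v' \<bullet> z \<le> v' \<bullet> x'" and ux': "u \<bullet> x' = c'" by blast
    \<comment> \<open>Equal hyperplanes have proportional normals: the part \<open>p\<close> of
      \<open>u\<close> orthogonal to \<open>w\<close> moves \<open>y\<close> inside the hyperplane,
      so \<open>u \<bullet> p = 0\<close>, which forces \<open>p = 0\<close>.\<close>
    have par: "u = (u \<bullet> w) *\<^sub>R w" if w: "norm w = 1" and y: "u \<bullet> y = d"
        and eq: "{z. u \<bullet> z = d} = {z. w \<bullet> z = w \<bullet> y}" for w y d
    proof (rule ccontr)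
      assume "u \<noteq> (u \<bullet> w) *\<^sub>R w"
      define p where "p = u - (u \<bullet> w) *\<^sub>R w"
      have wp: "w \<bullet> p = 0" using w by (simp add: p_def inner_diff inner_commute power2_norm_eq_inner[symmetric])
      then have "y + p \<in> {z. w \<bullet> z = w \<bullet> y}" by (simp add: inner_add)
      then have "y + p \<in> {z. u \<bullet> z = d}" using eq by simp
      then have "u \<bullet> p = 0" using y by (simp add: inner_add)
      moreover have "p \<bullet> p = u \<bullet> p - (u \<bullet> w) * (w \<bullet> p)"
        by (subst (1) p_def) (simp add: inner_diff_left)
      ultimately have "p \<bullet> p = 0" using wp by simp
      then show False using \<open>u \<noteq> _\<close> by (simp add: p_def)
    qed
    note pv = par[OF v ux H] and pv' = par[OF v' ux' H']
    have k: "x - v \<in> K" by (rule self_dual_opposite_point[OF K x v sup])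
    have k': "x' - v' \<in> K" by (rule self_dual_opposite_point[OF K x' v' sup'])
    define s where "s = u \<bullet> v"
    define s' where "s' = u \<bullet> v'"
    have us: "u = s *\<^sub>R v" "u = s' *\<^sub>R v'" using pv pv' by (simp_all add: s_def s'_def)
    have c: "c = s * (v \<bullet> x)" "c' = s' * (v' \<bullet> x')" using ux ux' us by (metis inner_scaleR_left)+
    have "v' = v \<or> v' = - v"
    proof -
      have "\<bar>s\<bar> = \<bar>s'\<bar>" using us v v' by (metis norm_scaleR mult.right_neutral)
      moreover have "s \<noteq> 0"
      proof
        assume "s = 0"
        then have "c = 0" "s' = 0" using c \<open>\<bar>s\<bar> = \<bar>s'\<bar>\<close> by auto
        then show False using c ne by simp
      qed
      ultimately have "s' = s \<or> s' = - s" by linarith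
      then show ?thesis
      proof
        assume "s' = s" then have "s *\<^sub>R v = s *\<^sub>R v'" using us by metis
        then show ?thesis using \<open>s \<noteq> 0\<close> by simp
      next
        assume "s' = - s" then have "s *\<^sub>R v = s *\<^sub>R (- v')" using us by (metis scaleR_minus_left scaleR_minus_right)
        then show ?thesis using \<open>s \<noteq> 0\<close> by (metis minus_minus scaleR_cancel_left)
      qed
    qed
    moreover have "v' \<noteq> v"
    proof
      assume eq: "v' = v"
      then have "v \<bullet> x = v \<bullet> x'" using sup[OF x'] sup'[OF x] by simp
      moreover have "s = s'" using eq by (simp add: s_def s'_def)
      ultimately show False using c ne eq by simp
    qed
    ultimately have neg: "v' = - v" by blast
    \<comment> \<open>The distance bound puts \<open>x'\<close> at depth at most \<open>1\<close>
      below \<open>x\<close>; support at \<open>x'\<close>, tested on the opposite point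
      \<open>x - v\<close>, puts it at depth at least \<open>1\<close>.\<close>
    have "v \<bullet> x' \<ge> v \<bullet> x - 1"
    proof -
      have "norm (x - x') \<le> 1" using x x' K by (metis mem_unit_ball_inter dist_norm)
      then show ?thesis using norm_cauchy_schwarz[of v "x - x'"] v by (simp add: inner_diff)
    qed
    moreover have "v \<bullet> x' \<le> v \<bullet> x - 1"
      using sup'[OF k] neg v by (simp add: inner_diff power2_norm_eq_inner[symmetric])
    ultimately have gap: "v \<bullet> x' = v \<bullet> x - 1" by simp
    have H'': "{z. u \<bullet> z = c'} = {z. v \<bullet> z = v \<bullet> x - 1}" unfolding H' neg using gap by (simp add: set_eq_iff) linarith
    have "setdist {z. v \<bullet> z = v \<bullet> x} {z. v \<bullet> z = v \<bullet> x - 1} = dist x (x - v)"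
    proof (rule setdist_unique)
      fix p q assume pq: "p \<in> {z. v \<bullet> z = v \<bullet> x} \<and> q \<in> {z. v \<bullet> z = v \<bullet> x - 1}"
      show "dist x (x - v) \<le> dist p q"
        using norm_cauchy_schwarz[of v "p - q"] v pq by (simp add: inner_diff dist_norm)
    qed (use v in \<open>simp_all add: inner_diff power2_norm_eq_inner[symmetric]\<close>)
    then show ?thesis unfolding H H'' using v by (simp add: dist_norm)
  qed
  then show ?thesis unfolding constant_width_body_def using cb by blast
qed

section \<open>Boundary points and smoothness\<close>

lemma dist_eq_1_notin_interior:
  fixes K :: "'a::euclidean_space set"
  assumes "unit_ball_inter K = K" "V \<in> K" "dist p V = 1"
  shows "p \<notin> interior K"
proof
  assume "p \<in> interior K"
  then obtain e where e: "e > 0" "cball p e \<subseteq> K" by (meson mem_interior_cball)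
  \<comment> \<open>Pushing \<open>p\<close> straight away from \<open>V\<close> stays in the small
    ball inside \<open>K\<close> but leaves the unit ball about \<open>V\<close>.\<close>
  define q where "q = p + e *\<^sub>R (p - V)"
  have "q \<in> cball p e" using assms(3) e by (simp add: q_def dist_norm norm_minus_commute)
  then have "dist V q \<le> 1" using e assms by (metis mem_unit_ball_inter subsetD)
  moreover have "q - V = (1 + e) *\<^sub>R (p - V)" by (simp add: q_def algebra_simps)
  then have "norm (q - V) = 1 + e" using assms(3) e by (simp add: dist_norm)
  then have "dist V q = 1 + e" by (simp add: dist_norm norm_minus_commute)
  ultimately show False using e by (simp add: norm_minus_commute[of V])
qed

lemma quadratic_three_roots:
  fixes a b c :: real
  assumes "distinct [r, s, t]" "a * r\<^sup>2 + b * r + c = 0" "a * s\<^sup>2 + b * s + c = 0" "a * t\<^sup>2 + b * t + c = 0"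
  shows "a = 0" "b = 0" "c = 0"
proof -
  have "(r - s) * (a * (r + s) + b) = 0" "(r - t) * (a * (r + t) + b) = 0"
    using assms by (auto simp: power2_eq_square algebra_simps)
  then have 1: "a * (r + s) + b = 0" "a * (r + t) + b = 0" using assms by auto
  then have "a * (s - t) = 0" unfolding distrib_left right_diff_distrib by linarith
  then show a: "a = 0" using assms by auto
  with 1 show "b = 0" by simp
  with a assms show "c = 0" by simp
qed

text \<open>A point of \<open>K\<close> with two normals has infinitely many opposite points, which lie on a unit
  circle about \<open>x\<close>. Such a circle has at most two points in common with the unit sphere about a
  point other than \<open>x\<close>.\<close>
lemma smooth_point_self_dual:
  fixes K :: "'a::euclidean_space set"
  assumes K: "unit_ball_inter K = K" and int: "interior K \<noteq> {}"
    and V: "finite V" "V \<subseteq> K" and x: "x \<in> frontier K" "x \<notin> V"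
    and opp: "\<And>y. y \<in> K \<Longrightarrow> dist x y = 1 \<Longrightarrow> \<exists>W\<in>V. dist y W = 1"
  shows "smooth_point K x"
proof -
  have ne: "K \<noteq> {}" using int by auto
  have co: "compact K" "convex K"
    using compact_unit_ball_inter[OF ne] convex_unit_ball_inter[of K] K by auto
  then have xK: "x \<in> K" using x compact_imp_closed frontier_subset_closed by blast
  have ex: "\<exists>H. supporting_hyperplane K H \<and> x \<in> H"
  proof -
    have "x \<notin> rel_interior K"
      using x int interior_rel_interior_gen[of K] by (auto simp: frontier_def interior_rel_interior_gen split: if_splits)
    then obtain a where a: "a \<noteq> 0" "\<And>y. y \<in> K \<Longrightarrow> a \<bullet> x \<le> a \<bullet> y"
      using supporting_hyperplane_rel_boundary[OF co(2) xK] by metis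
    have "supporting_hyperplane K {z. (- a) \<bullet> z = (- a) \<bullet> x}"
      unfolding supporting_hyperplane_def
      by (rule exI[of _ "- a"], rule exI[of _ "(- a) \<bullet> x"]) (use a xK in auto)
    then show ?thesis by blast
  qed
  moreover have "H1 = H2" if H1: "supporting_hyperplane K H1" "x \<in> H1"
    and H2: "supporting_hyperplane K H2" "x \<in> H2" for H1 H2
  proof -
    obtain u1 where u1: "norm u1 = 1" "H1 = {z. u1 \<bullet> z = u1 \<bullet> x}" "\<And>z. z \<in> K \<Longrightarrow> u1 \<bullet> z \<le> u1 \<bullet> x"
      using supporting_hyperplane_normalized[OF H1] by blast
    obtain u2 where u2: "norm u2 = 1" "H2 = {z. u2 \<bullet> z = u2 \<bullet> x}" "\<And>z. z \<in> K \<Longrightarrow> u2 \<bullet> z \<le> u2 \<bullet> x"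
      using supporting_hyperplane_normalized[OF H2] by blast
    \<comment> \<open>Nonnegative combinations of two outer normals are again outer normals; for
      \<open>t\<close> in \<open>(0, 1)\<close> the norm is at least \<open>1 - t\<close>, so
      \<open>v t\<close> is nonzero even if \<open>u2 = - u1\<close>.\<close>
    define v where "v t = u1 + t *\<^sub>R u2" for t
    have nz: "norm (v t) > 0" if "t \<in> {0<..<1}" for t
      using norm_triangle_ineq2[of u1 "- t *\<^sub>R u2"] that u1 u2 by (auto simp: v_def)
    have "\<exists>W\<in>V. dist (x - v t /\<^sub>R norm (v t)) W = 1" if t: "t \<in> {0<..<1}" for t
    proof (rule opp)
      show "x - v t /\<^sub>R norm (v t) \<in> K"
      proof (rule self_dual_opposite_point[OF K xK])
        fix z assume z: "z \<in> K"
        have "v t \<bullet> z \<le> v t \<bullet> x"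
          using u1(3)[OF z] u2(3)[OF z] t by (simp add: v_def inner_add add_mono mult_left_mono)
        then show "(v t /\<^sub>R norm (v t)) \<bullet> z \<le> (v t /\<^sub>R norm (v t)) \<bullet> x"
          using nz[OF t] by (simp add: divide_right_mono)
      qed (use nz[OF t] in auto)
      show "dist x (x - v t /\<^sub>R norm (v t)) = 1" using nz[OF t] by (simp add: dist_norm)
    qed
    then have cover: "{0<..<1} \<subseteq> (\<Union>W\<in>V. {t\<in>{0<..<1}. dist (x - v t /\<^sub>R norm (v t)) W = 1})"
      by blast
    \<comment> \<open>Finitely many \<open>W\<close> serve infinitely many \<open>t\<close>, so one
      \<open>W\<close> serves three of them, enough to annihilate a quadratic.\<close>
    have "infinite {0<..<1::real}" by simp
    then obtain W where W: "W \<in> V" and inf: "infinite {t\<in>{0<..<1}. dist (x - v t /\<^sub>R norm (v t)) W = 1}"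
      using V(1) cover by (meson finite_UN finite_subset)
    obtain T where T: "T \<subseteq> {t\<in>{0<..<1}. dist (x - v t /\<^sub>R norm (v t)) W = 1}" "card T = 3" "finite T"
      using infinite_arbitrarily_large[OF inf, of 3] by blast
    obtain r s t where "T = {r, s, t}" "r \<noteq> s" "s \<noteq> t" "r \<noteq> t"
      using T(2) unfolding card_3_iff by blast
    then have rst: "T = {r, s, t}" "distinct [r, s, t]" by auto
    define n where "n = x - W"
    define N where "N = (norm n)\<^sup>2"
    have N: "N > 0" using x W by (auto simp: N_def n_def)
    define p where "p = u1 \<bullet> n"
    define q where "q = u2 \<bullet> n"
    define c where "c = u1 \<bullet> u2"
    have pq: "p \<ge> 0" "q \<ge> 0"
      using u1(3)[of W] u2(3)[of W] W V by (auto simp: p_def q_def n_def inner_diff)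
    \<comment> \<open>Distance \<open>1\<close> from \<open>W\<close> means
      \<open>N * norm (v t) = 2 * (n \<bullet> v t)\<close>; squaring gives a quadratic in
      \<open>t\<close>.\<close>
    have root: "(4 * q\<^sup>2 - N\<^sup>2) * t\<^sup>2 + (8 * p * q - 2 * N\<^sup>2 * c) * t + (4 * p\<^sup>2 - N\<^sup>2) = 0"
      if t: "t \<in> T" for t
    proof -
      have t01: "t \<in> {0<..<1}" and d: "norm (n - v t /\<^sub>R norm (v t)) = 1"
        using t T by (auto simp: n_def dist_norm algebra_simps)
      have "1 = (norm (n + (- inverse (norm (v t))) *\<^sub>R v t))\<^sup>2" using d by simp
      also have "\<dots> = N - 2 * (n \<bullet> v t) / norm (v t) + 1"
        unfolding norm_add_scaleR_sq N_def using nz[OF t01] by (simp add: field_simps)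
      finally have "N * norm (v t) = 2 * (n \<bullet> v t)" using nz[OF t01] by (simp add: field_simps)
      then have "(N * norm (v t))\<^sup>2 = (2 * (n \<bullet> v t))\<^sup>2" by simp
      then have "N\<^sup>2 * (norm (v t))\<^sup>2 = 4 * (n \<bullet> v t)\<^sup>2"
        by (simp add: power_mult_distrib)
      moreover have "(norm (v t))\<^sup>2 = 1 + 2 * t * c + t\<^sup>2"
        using u1 u2 by (simp add: v_def norm_add_scaleR_sq c_def)
      moreover have "n \<bullet> v t = p + t * q" by (simp add: v_def p_def q_def inner_add inner_commute)
      ultimately show ?thesis by (simp add: power2_eq_square algebra_simps)
    qed
    \<comment> \<open>As \<open>p\<close> and \<open>q\<close> are nonnegative, both equal
      \<open>N / 2\<close>; the middle coefficient then gives \<open>c = 1\<close>, that is,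
      \<open>u1 = u2\<close>.\<close>
    have "4 * q\<^sup>2 - N\<^sup>2 = 0" "8 * p * q - 2 * N\<^sup>2 * c = 0" "4 * p\<^sup>2 - N\<^sup>2 = 0"
      using quadratic_three_roots[OF rst(2) root root root] rst(1) by auto
    then have qN: "(2 * q)\<^sup>2 = N\<^sup>2" "(2 * p)\<^sup>2 = N\<^sup>2" and e: "8 * p * q = 2 * N\<^sup>2 * c"
      by (simp_all add: power_mult_distrib)
    then have "2 * q = N" "2 * p = N" using pq N power2_eq_imp_eq[OF qN(1)] power2_eq_imp_eq[OF qN(2)] by simp_all
    with e N have "c = 1" by (auto simp: power2_eq_square)
    then have "(norm (u1 - u2))\<^sup>2 = 0"
      using u1 u2 by (simp add: c_def power2_norm_eq_inner inner_diff inner_commute norm_eq_1)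
    then show ?thesis using u1 u2 by simp
  qed
  ultimately show ?thesis unfolding smooth_point_def using x by blast
qed

section \<open>The body in coordinates\<close>

text \<open>Coordinates: scaled by \<open>sqrt 2\<close>, the vertices are the four standard basis vectors and \<open>apex\<close>, a
  multiple of \<open>(1, 1, 1, 1)\<close>. Here \<open>lam x + lam y \<le> x \<bullet> y\<close> says \<open>dist x y \<le> sqrt 2\<close>, the analogue of
  distance at most \<open>1\<close>; in particular \<open>lam x \<le> x $ i\<close> bounds the distance to a basis vector.\<close>
definition lam :: "real ^ 4 \<Rightarrow> real" where
  "lam x = ((norm x)\<^sup>2 - 1) / 2"

text \<open>The part of \<open>core_body\<close> outside the open unit ball, by
  \<open>region_subset_core_body\<close> and \<open>core_body_in_region\<close>.\<close>

definition region :: "(real ^ 4) set" where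
  "region = {x. 0 \<le> lam x \<and> (\<forall>i. lam x \<le> x $ i)}"

text \<open>The coordinate form of \<open>M0\<close>: the two equations put \<open>x\<close> at
  distance \<open>sqrt 2\<close> from two basis vectors, hence on a face through
  \<open>apex\<close>.\<close>

definition core :: "(real ^ 4) set" where
  "core = {x \<in> region. \<exists>i j. i \<noteq> j \<and> x $ i = lam x \<and> x $ j = lam x}"

definition core_body :: "(real ^ 4) set" where
  "core_body = {x. \<forall>P\<in>core. lam x + lam P \<le> x \<bullet> P}"

text \<open>The golden ratio; \<open>h = phi / 2\<close> is the positive root of
  \<open>4 * h\<^sup>2 = 1 + 2 * h\<close>, the condition for \<open>(h, h, h, h)\<close> to be at
  distance \<open>sqrt 2\<close> from the basis vectors.\<close>

definition phi :: real where "phi = (1 + sqrt 5) / 2"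

definition apex :: "real ^ 4" where "apex = (\<chi> i. phi / 2)"

section \<open>Identities for \<open>lam\<close> and \<open>apex\<close>, and points of
  \<open>core\<close>\<close>

lemma inner_real4: "x \<bullet> y = x$1 * y$1 + x$2 * y$2 + x$3 * y$3 + x$4 * (y$4::real)"
  for x y :: "real ^ 4"
  by (simp add: inner_vec_def sum_4)

lemma norm_real4: "(norm x)\<^sup>2 = (x$1)\<^sup>2 + (x$2)\<^sup>2 + (x$3)\<^sup>2 + (x$4 :: real)\<^sup>2"
  for x :: "real ^ 4"
  unfolding power2_norm_eq_inner inner_real4 by (simp add: power2_eq_square)

lemma norm_eq_lam: "(norm x)\<^sup>2 = 1 + 2 * lam x"
  by (simp add: lam_def diff_divide_distrib)

lemma lam_ge: "- 1 / 2 \<le> lam x"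
  by (simp add: lam_def)

lemma dist_sq_lam: "(dist x y)\<^sup>2 = 2 + 2 * (lam x + lam y - x \<bullet> y)"
proof -
  have "(dist x y)\<^sup>2 = (norm x)\<^sup>2 + (norm y)\<^sup>2 - 2 * (x \<bullet> y)"
    unfolding dist_norm power2_norm_eq_inner by (simp add: inner_diff inner_commute)
  then show ?thesis by (simp add: norm_eq_lam)
qed

lemma phi_sq: "phi\<^sup>2 = phi + 1"
  by (simp add: phi_def power2_eq_square field_simps)

lemma phi_bounds: "8 / 5 < phi" "phi < 17 / 10"
proof -
  have "11 / 5 < sqrt 5" by (rule real_less_rsqrt) (simp add: power2_eq_square)
  then show "8 / 5 < phi" by (simp add: phi_def)
  have "sqrt 5 < 12 / 5" by (rule real_less_lsqrt) (simp_all add: power2_eq_square)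
  then show "phi < 17 / 10" by (simp add: phi_def)
qed

lemma lam_apex: "lam apex = phi / 2"
proof -
  have "(norm apex)\<^sup>2 = phi\<^sup>2" unfolding norm_real4 by (simp add: apex_def power_divide)
  then show ?thesis unfolding lam_def phi_sq by simp
qed

lemma apex_core: "apex \<in> core"
proof -
  have "apex $ i = phi / 2" for i by (simp add: apex_def)
  moreover have "\<exists>i j :: 4. i \<noteq> j" by (rule exI[of _ 1], rule exI[of _ 2]) simp
  ultimately show ?thesis
    unfolding core_def region_def using phi_bounds by (simp add: lam_apex)
qed

lemma pair_complement:
  fixes i j :: 4
  assumes "i \<noteq> j"
  shows "\<exists>k m. - {i, j} = {k, m} \<and> k \<noteq> m"
proof -
  have "card (- {i, j}) = 2" using assms by (simp add: Compl_eq_Diff_UNIV card_Diff_subset)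
  then show ?thesis by (meson card_2_iff)
qed

text \<open>On these quarter circles \<open>lam\<close> is \<open>0\<close>, and so are the two
  remaining coordinates, which are the two equalities that \<open>core\<close> asks for.\<close>

lemma arc_core:
  assumes "0 \<le> p" "0 \<le> q" "p\<^sup>2 + q\<^sup>2 = 1" "i \<noteq> j"
  shows "p *\<^sub>R axis i 1 + q *\<^sub>R axis j 1 \<in> core"
    and "lam (p *\<^sub>R axis i 1 + q *\<^sub>R axis j 1) = 0"
proof -
  let ?P = "p *\<^sub>R axis i 1 + q *\<^sub>R axis j 1 :: real ^ 4"
  have "(norm ?P)\<^sup>2 = p\<^sup>2 + q\<^sup>2"
    unfolding power2_norm_eq_inner using assms(4)
    by (simp add: inner_add inner_axis_axis power2_eq_square)
  then show l: "lam ?P = 0" using assms by (simp add: lam_def)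
  have nn: "0 \<le> ?P $ k" for k using assms by (simp add: axis_def)
  obtain k m where km: "- {i, j} = {k, m}" "k \<noteq> m" using pair_complement[OF assms(4)] by blast
  then have "k \<notin> {i, j}" "m \<notin> {i, j}" by blast+
  then have "?P $ k = 0" "?P $ m = 0" by (auto simp: axis_def)
  then show "?P \<in> core" unfolding core_def region_def using l nn km(2) by auto
qed

lemma axis_core: "axis i 1 \<in> core" and lam_axis: "lam (axis i 1) = 0"
proof -
  obtain j where "j \<noteq> (i :: 4)" by (metis (full_types) zero_neq_one)
  then show "axis i 1 \<in> core" "lam (axis i 1) = 0" using arc_core[of 1 0 i j] by auto
qed

section \<open>Two points outside the open unit ball\<close>

lemma region_bounds:
  assumes "x \<in> region"
  shows "lam x < 1" and "1 \<le> x$1 + x$2 + x$3 + x$4 - 2 * lam x"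
proof -
  define l where "l = lam x"
  define u where "u i = x $ i - l" for i
  have l0: "0 \<le> l" and u0: "0 \<le> u i" for i
    using assms by (auto simp: region_def l_def u_def)
  have xi: "x $ i = u i + l" for i by (simp add: u_def)
  have N: "(u 1 + l)\<^sup>2 + (u 2 + l)\<^sup>2 + (u 3 + l)\<^sup>2 + (u 4 + l)\<^sup>2 = 1 + 2 * l"
    using norm_eq_lam[of x] unfolding norm_real4 xi l_def[symmetric] by simp
  have "l\<^sup>2 \<le> (u i + l)\<^sup>2" for i using l0 u0 by (intro power_mono) auto
  from this[of 1] this[of 2] this[of 3] this[of 4] have 4: "4 * l\<^sup>2 \<le> 1 + 2 * l" using N by linarith
  show l1: "lam x < 1"
  proof (rule ccontr)
    assume "\<not> lam x < 1"
    then have l1: "1 \<le> l" by (simp add: l_def)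
    then have "l * 1 \<le> l * l" by (intro mult_left_mono) auto
    with 4 l1 show False unfolding power2_eq_square by linarith
  qed
  \<comment> \<open>By \<open>N\<close>, the difference of the two squares is
    \<open>4 * l * (1 - l)\<close> plus twice the sum of the products \<open>u i * u j\<close> over
    pairs.\<close>
  have "(1 - l)\<^sup>2 \<le> (u 1 + u 2 + u 3 + u 4 + l)\<^sup>2"
  proof -
    have "l * l \<le> l * 1" using l0 l1 by (intro mult_left_mono) (auto simp: l_def)
    moreover have "0 \<le> u i * u j" for i j using u0 by simp
    then have "0 \<le> u 1 * u 2 + u 1 * u 3 + u 1 * u 4 + u 2 * u 3 + u 2 * u 4 + u 3 * u 4"
      by (intro add_nonneg_nonneg)
    ultimately show ?thesis using N by (simp add: power2_eq_square algebra_simps)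
  qed
  then have "1 - l \<le> u 1 + u 2 + u 3 + u 4 + l"
    by (rule power2_le_imp_le) (use l0 u0 in \<open>simp add: add_nonneg_nonneg\<close>)
  then show "1 \<le> x$1 + x$2 + x$3 + x$4 - 2 * lam x" by (simp add: u_def l_def)
qed

lemma two_zeros:
  assumes "\<And>i :: 4. P i \<or> Q i"
  shows "(\<exists>i j. i \<noteq> j \<and> P i \<and> P j) \<or> (\<exists>i j. i \<noteq> j \<and> Q i \<and> Q j)"
proof -
  have "(1::4) \<noteq> 2" "(1::4) \<noteq> 3" "(2::4) \<noteq> 3" by simp_all
  then show ?thesis using assms[of 1] assms[of 2] assms[of 3] by metis
qed

text \<open>The difference \<open>x \<bullet> y - lam x - lam y\<close> splits into the sum
  \<open>S\<close> of the products \<open>u i * v i\<close> and two terms that are nonnegative by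
  \<open>region_bounds\<close>. Equality makes every product vanish, so by pigeonhole one point has
  two coordinates equal to its \<open>lam\<close>.\<close>

lemma region_inner:
  assumes "x \<in> region" "y \<in> region"
  shows "lam x + lam y \<le> x \<bullet> y"
    and "lam x + lam y = x \<bullet> y \<Longrightarrow> x \<in> core \<or> y \<in> core"
proof -
  define u where "u i = x $ i - lam x" for i
  define v where "v i = y $ i - lam y" for i
  have uv: "0 \<le> u i * v i" for i using assms by (auto simp: region_def u_def v_def)
  define S where "S = u 1 * v 1 + u 2 * v 2 + u 3 * v 3 + u 4 * v 4"
  have "0 \<le> lam y * (x$1 + x$2 + x$3 + x$4 - 2 * lam x - 1)"
       "0 \<le> lam x * (y$1 + y$2 + y$3 + y$4 - 2 * lam y - 1)"
    using assms region_bounds(2)[OF assms(1)] region_bounds(2)[OF assms(2)]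
    by (auto simp: region_def)
  moreover have "x \<bullet> y - lam x - lam y = S
      + lam y * (x$1 + x$2 + x$3 + x$4 - 2 * lam x - 1)
      + lam x * (y$1 + y$2 + y$3 + y$4 - 2 * lam y - 1)"
    unfolding inner_real4 S_def u_def v_def by (simp add: algebra_simps)
  ultimately have S: "S \<le> x \<bullet> y - lam x - lam y" by linarith
  have "0 \<le> S" unfolding S_def using uv by (intro add_nonneg_nonneg)
  with S show "lam x + lam y \<le> x \<bullet> y" by simp
  assume "lam x + lam y = x \<bullet> y"
  with S have "S \<le> 0" by simp
  then have "u 1 * v 1 = 0" "u 2 * v 2 = 0" "u 3 * v 3 = 0" "u 4 * v 4 = 0"
    using uv[of 1] uv[of 2] uv[of 3] uv[of 4] unfolding S_def by linarith+
  then have "\<forall>i. u i * v i = 0" by (simp add: forall_4)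
  then have "x $ i = lam x \<or> y $ i = lam y" for i by (auto simp: u_def v_def)
  from two_zeros[of "\<lambda>i. x $ i = lam x" "\<lambda>i. y $ i = lam y", OF this]
  show "x \<in> core \<or> y \<in> core" using assms by (auto simp: core_def)
qed

lemma region_subset_core_body: "region \<subseteq> core_body"
  using region_inner(1) by (auto simp: core_body_def core_def)

lemma core_subset_region: "core \<subseteq> region"
  by (auto simp: core_def)

lemma core_body_axis: "x \<in> core_body \<Longrightarrow> lam x \<le> x $ i"
  using axis_core[of i] lam_axis[of i] by (auto simp: core_body_def inner_axis)

lemma core_body_in_region: "x \<in> core_body \<Longrightarrow> 0 \<le> lam x \<Longrightarrow> x \<in> region"
  using core_body_axis by (auto simp: region_def)

section \<open>Points inside the unit ball: positive and negative parts\<close>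

definition negpart :: "real ^ 4 \<Rightarrow> real ^ 4" where
  "negpart x = (\<chi> i. max 0 (- x $ i))"

definition pospart :: "real ^ 4 \<Rightarrow> real ^ 4" where
  "pospart x = (\<chi> i. max 0 (x $ i))"

lemma pos_neg_decomp: "x = pospart x - negpart x"
  by (auto simp: vec_eq_iff pospart_def negpart_def max_def)

lemma pos_neg_nonneg: "0 \<le> pospart x $ i" "0 \<le> negpart x $ i"
  by (simp_all add: pospart_def negpart_def)

lemma inner_nonneg_vec: "(\<And>i. 0 \<le> x $ i) \<Longrightarrow> (\<And>i. 0 \<le> y $ i) \<Longrightarrow> 0 \<le> x \<bullet> y"
  for x y :: "real ^ 4"
  by (simp add: inner_real4)

lemma norm_pospart_le: "norm (pospart x) \<le> norm x"
proof -
  have "(pospart x $ i)\<^sup>2 \<le> (x $ i)\<^sup>2" for i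
    by (simp add: pospart_def max_def)
  then have "(norm (pospart x))\<^sup>2 \<le> (norm x)\<^sup>2" unfolding norm_real4 by (intro add_mono)
  then show ?thesis by (rule power2_le_imp_le) simp
qed

lemma pair_or_triple:
  fixes P :: "4 \<Rightarrow> bool"
  shows "(\<exists>i j. i \<noteq> j \<and> (\<forall>k. k \<noteq> i \<longrightarrow> k \<noteq> j \<longrightarrow> \<not> P k)) \<or> (\<exists>d. \<forall>k. k \<noteq> d \<longrightarrow> P k)"
proof (cases "\<exists>i j. i \<noteq> j \<and> \<not> P i \<and> \<not> P j")
  case True
  then obtain i j where ij: "i \<noteq> j" "\<not> P i" "\<not> P j" by blast
  obtain k m where km: "- {i, j} = {k, m}" "k \<noteq> m" using pair_complement[OF ij(1)] by blast
  have "\<not> P l" if "l \<noteq> k" "l \<noteq> m" for l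
  proof -
    have "l \<notin> - {i, j}" unfolding km(1) using that by simp
    then show ?thesis using ij by auto
  qed
  then show ?thesis using km(2) by blast
next
  case False
  then show ?thesis by metis
qed

text \<open>The arcs of \<open>core\<close> in the coordinate planes control two negative coordinates, and the apex
  excludes three substantially negative ones.\<close>
lemma negpart_bound:
  assumes x: "x \<in> core_body" and neg: "lam x < 0"
  shows "norm (negpart x) \<le> - lam x"
    and "(\<And>k. k \<noteq> d \<Longrightarrow> x $ k < 0) \<Longrightarrow> norm (negpart x) < - lam x"
proof -
  have three: "norm (negpart x) < - lam x" if ng: "\<And>k. k \<noteq> d \<Longrightarrow> x $ k < 0" for d
  proof -
    define s where "s = (\<Sum>k\<in>UNIV. negpart x $ k)"
    define S where "S = (\<Sum>k\<in>UNIV. x $ k)"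
    have ax: "lam x + phi / 2 \<le> phi / 2 * S"
    proof -
      have "lam x + lam apex \<le> x \<bullet> apex" using x apex_core by (auto simp: core_body_def)
      moreover have "x \<bullet> apex = phi / 2 * S"
        by (simp add: inner_real4 apex_def S_def sum_4 algebra_simps)
      ultimately show ?thesis by (simp add: lam_apex)
    qed
    have pd: "0 \<le> x $ d"
    proof (rule ccontr)
      assume "\<not> 0 \<le> x $ d"
      then have "x $ k < 0" for k using ng by (cases "k = d") auto
      then have "S \<le> 0" unfolding S_def by (intro sum_nonpos) (simp add: less_imp_le)
      then have "phi / 2 * S \<le> 0" using phi_bounds by (simp add: mult_le_0_iff)
      then show False using ax lam_ge[of x] phi_bounds by linarith
    qed
    have Ss: "S = x $ d - s"
    proof -
      have "S = x $ d + (\<Sum>k\<in>UNIV - {d}. x $ k)" unfolding S_def by (subst sum.remove[of _ d]) auto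
      moreover have "s = 0 + (\<Sum>k\<in>UNIV - {d}. - x $ k)"
        unfolding s_def using pd ng
        by (subst sum.remove[of _ d]) (auto simp: negpart_def max_def less_imp_le intro!: sum.cong dest: less_imp_le)
      ultimately show ?thesis by (simp add: sum_negf)
    qed
    have nx: "(x $ d)\<^sup>2 \<le> 1 + 2 * lam x"
    proof -
      have "\<bar>x $ d\<bar> \<le> norm x" by (rule component_le_norm_cart)
      then have "(x $ d)\<^sup>2 \<le> (norm x)\<^sup>2" using pd by (simp add: abs_le_square_iff[symmetric])
      then show ?thesis by (simp add: norm_eq_lam)
    qed
    \<comment> \<open>With \<open>ax\<close> this bounds the sum \<open>s\<close> of the negative
      parts by \<open>(2 - phi) / phi\<close> times \<open>- lam x\<close>; the factor is below
      \<open>1\<close> because \<open>phi > 1\<close>.\<close>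
    have "1 - x $ d \<ge> - lam x"
    proof -
      have "2 * x $ d \<le> 1 + (x $ d)\<^sup>2" using sum_squares_bound[of 1 "x $ d"] by simp
      then show ?thesis using nx by simp
    qed
    then have "phi * (- lam x) \<le> phi * (1 - x $ d)" using phi_bounds by (intro mult_left_mono) auto
    moreover have "2 * lam x + phi \<le> phi * (x $ d) - phi * s" using ax Ss by (simp add: algebra_simps)
    ultimately have "phi * s \<le> (2 - phi) * (- lam x)" by (simp add: algebra_simps)
    also have "\<dots> < phi * (- lam x)" using neg phi_bounds by (intro mult_strict_right_mono) auto
    finally have "s < - lam x" by (rule mult_left_less_imp_less) (use phi_bounds in simp)
    moreover have "norm (negpart x) \<le> s"
      unfolding s_def using norm_le_l1_cart[of "negpart x"] pos_neg_nonneg(2)[of x] by simp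
    ultimately show ?thesis by simp
  qed
  show "norm (negpart x) < - lam x" if "\<And>k. k \<noteq> d \<Longrightarrow> x $ k < 0" using three[OF that] .
  show "norm (negpart x) \<le> - lam x"
  proof (cases "\<exists>d. \<forall>k. k \<noteq> d \<longrightarrow> x $ k < 0")
    case True
    then obtain d where "\<And>k. k \<noteq> d \<Longrightarrow> x $ k < 0" by blast
    then show ?thesis by (rule less_imp_le[OF three])
  next
    case False
    then obtain i j where ij: "i \<noteq> j" and nn: "\<And>k. k \<noteq> i \<Longrightarrow> k \<noteq> j \<Longrightarrow> \<not> x $ k < 0"
      using pair_or_triple[of "\<lambda>k. x $ k < 0"] by metis
    define a where "a = negpart x $ i"
    define b where "b = negpart x $ j"
    define r where "r = norm (negpart x)"
    have np: "negpart x = a *\<^sub>R axis i 1 + b *\<^sub>R axis j 1"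
    proof (subst vec_eq_iff, intro allI)
      fix k
      show "negpart x $ k = (a *\<^sub>R axis i 1 + b *\<^sub>R axis j 1) $ k"
        using nn[of k] ij by (cases "k = i"; cases "k = j") (auto simp: a_def b_def axis_def negpart_def)
    qed
    have r2: "r\<^sup>2 = a\<^sup>2 + b\<^sup>2"
      unfolding r_def power2_norm_eq_inner using ij
      by (subst (1 2) np) (simp add: inner_add inner_axis_axis power2_eq_square)
    show ?thesis
    proof (cases "r = 0")
      case True then show ?thesis using neg by (simp add: r_def)
    next
      case False
      then have r: "r > 0" by (simp add: r_def)
      \<comment> \<open>This is \<open>negpart x\<close> normalised, a point of a quarter circle;
        since \<open>lam\<close> vanishes there and \<open>x \<bullet> ?P = - r\<close>, the ball
        about it gives the bound.\<close>
      let ?P = "(a / r) *\<^sub>R axis i 1 + (b / r) *\<^sub>R axis j 1 :: real ^ 4"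
      have ab: "0 \<le> a" "0 \<le> b" by (simp_all add: a_def b_def pos_neg_nonneg)
      have "(a / r)\<^sup>2 + (b / r)\<^sup>2 = 1" using r by (simp add: power_divide add_divide_distrib[symmetric] r2[symmetric])
      then have P: "?P \<in> core" "lam ?P = 0" using ab r ij by (intro arc_core; simp)+
      have "x \<bullet> ?P = (a * x $ i + b * x $ j) / r"
        by (simp add: inner_add inner_axis add_divide_distrib)
      also have "a * x $ i = - a\<^sup>2" by (simp add: a_def negpart_def max_def power2_eq_square)
      also have "b * x $ j = - b\<^sup>2" by (simp add: b_def negpart_def max_def power2_eq_square)
      also have "(- a\<^sup>2 + - b\<^sup>2) / r = - r" using r2 r by (simp add: power2_eq_square field_simps)
      finally have "x \<bullet> ?P = - r" .
      then have "lam x \<le> - r" using x P by (force simp: core_body_def)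
      then show ?thesis by (simp add: r_def)
    qed
  qed
qed

text \<open>Expanding into positive and negative parts, only the two mixed terms work against the
  claim. By Cauchy-Schwarz each is smaller than \<open>- lam\<close> of the point contributing its
  negative part, since positive parts have norm below \<open>1\<close> inside the ball.\<close>

lemma inner_inside_inside:
  assumes "x \<in> core_body" "y \<in> core_body" "lam x < 0" "lam y < 0"
  shows "lam x + lam y < x \<bullet> y"
proof -
  have bound: "pospart x \<bullet> negpart y < - lam y" if "lam x < 0" "y \<in> core_body" "lam y < 0" for x y
  proof -
    have "(norm x)\<^sup>2 < 1" using that(1) norm_eq_lam[of x] by simp
    then have "norm (pospart x) < 1" using norm_pospart_le[of x] by (simp add: power_less_one_iff)
    have "pospart x \<bullet> negpart y \<le> norm (pospart x) * norm (negpart y)" by (rule norm_cauchy_schwarz)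
    also have "\<dots> \<le> norm (pospart x) * (- lam y)"
      using negpart_bound(1)[OF that(2,3)] by (intro mult_left_mono) auto
    also have "\<dots> < 1 * (- lam y)" using \<open>norm (pospart x) < 1\<close> that by (intro mult_strict_right_mono) auto
    finally show ?thesis by simp
  qed
  have "x \<bullet> y = pospart x \<bullet> pospart y + negpart x \<bullet> negpart y - pospart x \<bullet> negpart y - pospart y \<bullet> negpart x"
    by (subst pos_neg_decomp[of x], subst pos_neg_decomp[of y]) (simp add: inner_diff inner_commute)
  moreover have "0 \<le> pospart x \<bullet> pospart y" "0 \<le> negpart x \<bullet> negpart y"
    by (simp_all add: inner_nonneg_vec pos_neg_nonneg)
  ultimately show ?thesis using bound[of x y] bound[of y x] assms by linarith
qed

lemma notin_core_coordinates:
  assumes "y \<in> region" "y \<notin> core"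
  obtains d where "\<And>k. k \<noteq> d \<Longrightarrow> lam y < y $ k"
proof (cases "\<exists>d. \<forall>k. k \<noteq> d \<longrightarrow> lam y < y $ k")
  case False
  then obtain i j where ij: "i \<noteq> j" and le: "\<And>k. k \<noteq> i \<Longrightarrow> k \<noteq> j \<Longrightarrow> \<not> lam y < y $ k"
    using pair_or_triple[of "\<lambda>k. lam y < y $ k"] by metis
  obtain k m where km: "- {i, j} = {k, m}" "k \<noteq> m" using pair_complement[OF ij] by blast
  then have "k \<notin> {i, j}" "m \<notin> {i, j}" by blast+
  then have "y $ k = lam y" "y $ m = lam y"
    using le[of k] le[of m] assms(1) by (auto simp: region_def intro: antisym)
  then have "y \<in> core" using assms(1) km(2) unfolding core_def by blast
  then show ?thesis using assms(2) by blast
qed (use that in blast)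

text \<open>Cauchy-Schwarz gives the weak inequality, with equality only if \<open>negpart x\<close>
  is \<open>- lam x\<close> times \<open>y\<close>. Then \<open>x\<close> is negative wherever
  \<open>y\<close> is positive, which for \<open>y\<close> outside \<open>core\<close> means at
  least three coordinates, and there \<open>negpart_bound\<close> is strict.\<close>

lemma inner_inside_sphere:
  assumes x: "x \<in> core_body" "lam x < 0" and y: "y \<in> region" "lam y = 0" "y \<notin> core"
  shows "lam x < x \<bullet> y"
proof (rule ccontr)
  assume "\<not> lam x < x \<bullet> y"
  then have le: "x \<bullet> y \<le> lam x" by simp
  have y0: "0 \<le> y $ i" for i using y by (auto simp: region_def)
  have "norm y = 1 \<or> norm y = - 1" using norm_eq_lam[of y] y by (simp add: power2_eq_1_iff)
  then have ny: "norm y = 1" using norm_ge_zero[of y] by linarith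
  have "x \<bullet> y = pospart x \<bullet> y - negpart x \<bullet> y"
    by (subst pos_neg_decomp[of x]) (simp add: inner_diff)
  moreover have "0 \<le> pospart x \<bullet> y" by (simp add: inner_nonneg_vec pos_neg_nonneg y0)
  ultimately have ge: "- lam x \<le> negpart x \<bullet> y" using le by simp
  have nb: "norm (negpart x) \<le> - lam x" by (rule negpart_bound(1)[OF x])
  then have nb2: "(norm (negpart x))\<^sup>2 \<le> (lam x)\<^sup>2"
    by (metis norm_ge_zero power2_minus power_mono)
  have "(norm (negpart x - (- lam x) *\<^sub>R y))\<^sup>2
      = (norm (negpart x))\<^sup>2 + 2 * lam x * (negpart x \<bullet> y) + (lam x)\<^sup>2"
    using norm_add_scaleR_sq[of "negpart x" "lam x" y] ny by simp
  also have "\<dots> \<le> 0"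
  proof -
    have "lam x * (negpart x \<bullet> y) \<le> lam x * (- lam x)" using ge x by (intro mult_left_mono_neg) auto
    then show ?thesis using nb2 by (simp add: power2_eq_square)
  qed
  finally have "negpart x - (- lam x) *\<^sub>R y = 0" by simp
  then have eq: "negpart x = (- lam x) *\<^sub>R y" by (rule eq_iff_diff_eq_0[THEN iffD2])
  have supp: "x $ k < 0" if "y $ k \<noteq> 0" for k
  proof -
    have "negpart x $ k = - lam x * y $ k" using eq by simp
    moreover have "\<dots> > 0" using x y0[of k] that by (simp add: mult_less_0_iff)
    ultimately show ?thesis by (simp add: negpart_def split: if_splits)
  qed
  obtain d where "\<And>k. k \<noteq> d \<Longrightarrow> lam y < y $ k" using notin_core_coordinates[OF y(1,3)] by blast
  then have "\<And>k. k \<noteq> d \<Longrightarrow> x $ k < 0" using supp y(2) by force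
  then have "norm (negpart x) < - lam x" by (rule negpart_bound(2)[OF x])
  then show False using eq ny x by simp
qed

section \<open>Farthest points outside the unit ball\<close>

lemma tendsto_lam: "(f \<longlongrightarrow> a) F \<Longrightarrow> ((\<lambda>t. lam (f t)) \<longlongrightarrow> lam a) F"
  unfolding lam_def by (intro tendsto_intros) auto

text \<open>A farthest point \<open>y\<close> beyond the unit sphere that is not in \<open>core\<close> lies on at most one of the
  spheres about the standard basis vectors \<open>c\<close>; then \<open>x\<close> is on the ray from \<open>y\<close> through \<open>c\<close>,
  at or beyond \<open>c\<close>, which puts it outside the unit ball.\<close>
lemma farthest_in_core:
  assumes neg: "lam x < 0" and y: "y \<in> region" "0 < lam y"
    and far: "\<And>z. z \<in> region \<Longrightarrow> dist x z \<le> dist x y" and D: "sqrt 2 \<le> dist x y"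
  shows "y \<in> core"
proof (rule ccontr)
  assume nc: "y \<notin> core"
  obtain d where d: "\<And>k. k \<noteq> d \<Longrightarrow> lam y < y $ k" using notin_core_coordinates[OF y(1) nc] by blast
  \<comment> \<open>The constraints on \<open>y\<close> other than the one for \<open>d\<close> are
    strict and survive a small step along \<open>w\<close>, while
    \<open>0 < (y - x) \<bullet> w\<close> increases the distance from \<open>x\<close>; what has to
    be supplied is the constraint for \<open>d\<close>.\<close>
  have move: False
    if w: "0 < (y - x) \<bullet> w" and ev: "eventually (\<lambda>e. lam (y + e *\<^sub>R w) \<le> (y + e *\<^sub>R w) $ d) (at_right 0)" for w
  proof -
    have ty: "((\<lambda>e. y + e *\<^sub>R w) \<longlongrightarrow> y + 0 *\<^sub>R w) (at_right 0)" by (intro tendsto_intros)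
    then have ty: "((\<lambda>e. y + e *\<^sub>R w) \<longlongrightarrow> y) (at_right 0)" by simp
    have tl: "((\<lambda>e. lam (y + e *\<^sub>R w)) \<longlongrightarrow> lam y) (at_right 0)" by (rule tendsto_lam[OF ty])
    have "eventually (\<lambda>e. 0 < lam (y + e *\<^sub>R w)) (at_right 0)" using tl y(2) by (rule order_tendstoD)
    moreover have "eventually (\<lambda>e. \<forall>k. k \<noteq> d \<longrightarrow> lam (y + e *\<^sub>R w) < (y + e *\<^sub>R w) $ k) (at_right 0)"
    proof (rule eventually_all_finite)
      fix k
      show "eventually (\<lambda>e. k \<noteq> d \<longrightarrow> lam (y + e *\<^sub>R w) < (y + e *\<^sub>R w) $ k) (at_right 0)"
      proof (cases "k = d")
        case False
        have "((\<lambda>e. (y + e *\<^sub>R w) $ k - lam (y + e *\<^sub>R w)) \<longlongrightarrow> y $ k - lam y) (at_right 0)"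
          by (intro tendsto_intros ty tl)
        moreover have "0 < y $ k - lam y" using d[OF False] by simp
        ultimately have "eventually (\<lambda>e. 0 < (y + e *\<^sub>R w) $ k - lam (y + e *\<^sub>R w)) (at_right 0)"
          by (rule order_tendstoD)
        then show ?thesis by eventually_elim simp
      qed simp
    qed
    moreover have "eventually (\<lambda>e. (0::real) < e) (at_right 0)" by (rule eventually_at_right_less)
    ultimately have "eventually (\<lambda>e. 0 < e \<and> y + e *\<^sub>R w \<in> region) (at_right 0)"
      using ev
    proof eventually_elim
      case (elim e)
      have "lam (y + e *\<^sub>R w) \<le> (y + e *\<^sub>R w) $ k" for k
        using elim(2,4) by (cases "k = d") (auto intro: less_imp_le)
      then show ?case unfolding region_def using elim(1,3) by (auto intro: less_imp_le)
    qed
    then obtain e where e: "0 < e" "y + e *\<^sub>R w \<in> region"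
      using eventually_happens'[OF trivial_limit_at_right_real] by blast
    have "(norm (y - x + e *\<^sub>R w))\<^sup>2 > (norm (y - x))\<^sup>2"
      unfolding norm_add_scaleR_sq using e(1) w by (simp add: add_pos_nonneg)
    then have "norm (y - x) < norm (y - x + e *\<^sub>R w)" by (rule power2_less_imp_less) simp
    moreover have "norm (y - x + e *\<^sub>R w) \<le> norm (y - x)"
      using far[OF e(2)] by (simp add: dist_norm norm_minus_commute[of x] algebra_simps)
    ultimately show False by simp
  qed
  have Dp: "0 < dist x y" using D by (meson less_le_trans real_sqrt_gt_0_iff zero_less_numeral)
  show False
  proof (cases "lam y < y $ d")
    case True
    show False
    proof (rule move[of "y - x"])
      show "0 < (y - x) \<bullet> (y - x)" using Dp by simp
      have ty: "((\<lambda>e. y + e *\<^sub>R (y - x)) \<longlongrightarrow> y + 0 *\<^sub>R (y - x)) (at_right 0)" by (intro tendsto_intros)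
      then have ty: "((\<lambda>e. y + e *\<^sub>R (y - x)) \<longlongrightarrow> y) (at_right 0)" by simp
      have "((\<lambda>e. (y + e *\<^sub>R (y - x)) $ d - lam (y + e *\<^sub>R (y - x))) \<longlongrightarrow> y $ d - lam y) (at_right 0)"
        by (intro tendsto_intros ty tendsto_lam)
      moreover have "0 < y $ d - lam y" using True by simp
      ultimately have "eventually (\<lambda>e. 0 < (y + e *\<^sub>R (y - x)) $ d - lam (y + e *\<^sub>R (y - x))) (at_right 0)"
        by (rule order_tendstoD)
      then show "eventually (\<lambda>e. lam (y + e *\<^sub>R (y - x)) \<le> (y + e *\<^sub>R (y - x)) $ d) (at_right 0)"
        by eventually_elim simp
    qed
  next
    case False
    then have yd: "y $ d = lam y" using y(1) by (auto simp: region_def intro: antisym)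
    define c where "c = (axis d 1 :: real ^ 4)"
    have sq: "(norm (z - c))\<^sup>2 = 2 + 2 * (lam z - z $ d)" for z
      using dist_sq_lam[of z c] lam_axis[of d] by (simp add: c_def inner_axis dist_norm)
    define a where "a = (y - x) /\<^sub>R dist x y"
    define b where "b = (y - c) /\<^sub>R sqrt 2"
    have yc2: "(norm (y - c))\<^sup>2 = 2" using sq[of y] yd by simp
    then have yc: "norm (y - c) = sqrt 2" by (metis norm_ge_zero real_sqrt_unique)
    have na: "norm a = 1" using Dp by (simp add: a_def dist_norm norm_minus_commute)
    have nb: "norm b = 1" using yc by (simp add: b_def)
    have ya: "y - x = dist x y *\<^sub>R a" using Dp by (simp add: a_def)
    have yb: "y - c = sqrt 2 *\<^sub>R b" by (simp add: b_def)
    \<comment> \<open>If the directions to \<open>y\<close> from \<open>x\<close> and from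
      \<open>c\<close> differ, a small step along \<open>a - b\<close> moves away from
      \<open>x\<close> but towards \<open>c\<close>, so it keeps the constraint for
      \<open>d\<close>.\<close>
    have "a = b"
    proof (rule ccontr)
      assume "a \<noteq> b"
      then have "0 < (norm (a - b))\<^sup>2" by simp
      also have "(norm (a - b))\<^sup>2 = 2 - 2 * (a \<bullet> b)"
        using norm_add_scaleR_sq[of a "- 1" b] na nb by simp
      finally have t: "a \<bullet> b < 1" by simp
      show False
      proof (rule move[of "a - b"])
        have aa: "a \<bullet> a = 1" "b \<bullet> b = 1" using na nb by (simp_all add: norm_eq_1)
        show "0 < (y - x) \<bullet> (a - b)"
          unfolding ya using Dp t aa by (simp add: inner_diff)
        have neg: "(y - c) \<bullet> (a - b) < 0"
          unfolding yb using t aa by (simp add: inner_diff inner_commute mult_less_0_iff)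
        have "((\<lambda>e. 2 * ((y - c) \<bullet> (a - b)) + e * (norm (a - b))\<^sup>2) \<longlongrightarrow>
            2 * ((y - c) \<bullet> (a - b)) + 0 * (norm (a - b))\<^sup>2) (at_right 0)"
          by (intro tendsto_intros)
        then have "eventually (\<lambda>e. 2 * ((y - c) \<bullet> (a - b)) + e * (norm (a - b))\<^sup>2 < 0) (at_right 0)"
          by (rule order_tendstoD) (use neg in simp)
        moreover have "eventually (\<lambda>e. (0::real) < e) (at_right 0)" by (rule eventually_at_right_less)
        ultimately show "eventually (\<lambda>e. lam (y + e *\<^sub>R (a - b)) \<le> (y + e *\<^sub>R (a - b)) $ d) (at_right 0)"
        proof eventually_elim
          case (elim e)
          have "(norm (y + e *\<^sub>R (a - b) - c))\<^sup>2 = (norm (y - c + e *\<^sub>R (a - b)))\<^sup>2"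
            by (simp add: algebra_simps)
          also have "\<dots> = 2 + e * (2 * ((y - c) \<bullet> (a - b)) + e * (norm (a - b))\<^sup>2)"
            unfolding norm_add_scaleR_sq yc2 by (simp add: power2_eq_square algebra_simps)
          also have "\<dots> \<le> 2" using elim by (simp add: mult_le_0_iff)
          finally show ?case unfolding sq by simp
        qed
      qed
    qed
    \<comment> \<open>In units of \<open>sqrt 2\<close>, \<open>r\<close> is how far
      \<open>x\<close> lies beyond \<open>c\<close> on the ray from \<open>y\<close>; as
      \<open>y $ d = lam y < 1\<close>, this makes the norm of \<open>x\<close> at least
      \<open>1\<close>.\<close>
    define r where "r = dist x y / sqrt 2 - 1"
    have r: "0 \<le> r" using D by (simp add: r_def)
    have "y - x = (1 + r) *\<^sub>R (y - c)" unfolding ya yb \<open>a = b\<close> by (simp add: r_def)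
    then have "x = c + (- r) *\<^sub>R (y - c)" by (simp add: algebra_simps)
    then have "(norm x)\<^sup>2 = (norm c)\<^sup>2 + 2 * (- r) * (c \<bullet> (y - c)) + (- r)\<^sup>2 * 2"
      by (simp only: norm_add_scaleR_sq yc2)
    also have "c \<bullet> (y - c) = y $ d - 1"
      by (simp add: c_def inner_diff inner_axis_axis inner_axis')
    also have "norm c = 1" by (simp add: c_def)
    finally have "(norm x)\<^sup>2 = 1 + 2 * r * (1 - y $ d) + r\<^sup>2 * 2"
      by (simp add: algebra_simps)
    moreover have "0 \<le> 2 * r * (1 - y $ d)" using r yd region_bounds(1)[OF y(1)] by simp
    ultimately have "1 \<le> (norm x)\<^sup>2" by simp
    then show False using neg norm_eq_lam[of x] by simp
  qed
qed

section \<open>The diameter of \<open>core_body\<close>\<close>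

lemma dist_le_sqrt2_iff: "dist x y \<le> sqrt 2 \<longleftrightarrow> lam x + lam y \<le> x \<bullet> y"
proof -
  have "dist x y \<le> sqrt 2 \<longleftrightarrow> (dist x y)\<^sup>2 \<le> (sqrt 2)\<^sup>2"
    by (subst power_mono_iff) auto
  then show ?thesis unfolding dist_sq_lam by auto
qed

lemma core_body_eq: "core_body = (\<Inter>P\<in>core. cball P (sqrt 2))"
  by (auto simp: core_body_def dist_le_sqrt2_iff inner_commute add.commute)

text \<open>Here \<open>sqrt 2\<close> is only a lower bound for the maximal distance, whose value
  \<open>core_body_dist\<close> derives from this lemma. The cases are the signs of
  \<open>lam x\<close> and \<open>lam y\<close>.\<close>

lemma diametral_pair_core:
  assumes x: "x \<in> core_body" and y: "y \<in> core_body"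
    and far: "\<And>z z'. z \<in> core_body \<Longrightarrow> z' \<in> core_body \<Longrightarrow> dist z z' \<le> dist x y"
    and D: "sqrt 2 \<le> dist x y"
  shows "x \<in> core \<or> y \<in> core"
proof -
  have "(sqrt 2)\<^sup>2 \<le> (dist x y)\<^sup>2" using D by (intro power_mono) auto
  then have le: "x \<bullet> y \<le> lam x + lam y" by (simp add: dist_sq_lam)
  have mixed: "y \<in> core" if x: "x \<in> core_body" "lam x < 0" and y: "y \<in> core_body" "0 \<le> lam y"
    and le: "x \<bullet> y \<le> lam x + lam y" and D: "sqrt 2 \<le> dist x y"
    and far: "\<And>z. z \<in> core_body \<Longrightarrow> dist x z \<le> dist x y" for x y
  proof -
    have yr: "y \<in> region" using core_body_in_region y by blast
    show ?thesis
    proof (cases "lam y = 0")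
      case True
      then show ?thesis using inner_inside_sphere[OF x yr] le by force
    next
      case False
      then show ?thesis
        using farthest_in_core[OF x(2) yr _ _ D] far region_subset_core_body y(2) by force
    qed
  qed
  consider "lam x < 0" "lam y < 0" | "lam x < 0" "0 \<le> lam y" | "0 \<le> lam x" "lam y < 0" | "0 \<le> lam x" "0 \<le> lam y"
    by linarith
  then show ?thesis
  proof cases
    case 1
    then show ?thesis using inner_inside_inside[OF x y] le by simp
  next
    case 2
    then show ?thesis using mixed[OF x _ y _ le D] far x by blast
  next
    case 3
    then show ?thesis
      using mixed[OF y _ x] far y le D by (metis add.commute dist_commute inner_commute)
  next
    case 4
    then have "x \<in> region" "y \<in> region" using core_body_in_region x y by blast+
    then show ?thesis using region_inner[of x y] le by force
  qed
qed

text \<open>A pair at maximal distance has an endpoint in \<open>core\<close>, and the ball of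
  radius \<open>sqrt 2\<close> about that endpoint contains the other one; two basis vectors supply
  the lower bound.\<close>

theorem core_body_dist:
  assumes x: "x \<in> core_body" and y: "y \<in> core_body"
  shows "dist x y \<le> sqrt 2" and "dist x y = sqrt 2 \<Longrightarrow> x \<in> core \<or> y \<in> core"
proof -
  have "compact core_body" unfolding core_body_eq
    by (rule compact_Inter) (use apex_core in auto)
  then obtain a b where ab: "a \<in> core_body" "b \<in> core_body" "dist a b = diameter core_body"
    using diameter_compact_attained x by blast
  have far: "dist z z' \<le> dist a b" if "z \<in> core_body" "z' \<in> core_body" for z z'
    using that ab(3) diameter_bounded_bound[OF compact_imp_bounded[OF \<open>compact core_body\<close>]] by simp
  have axes: "axis i 1 \<in> core_body" for i
    using axis_core core_subset_region region_subset_core_body by blast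
  have "(dist (axis 1 1) (axis 2 1 :: real ^ 4))\<^sup>2 = 2"
    by (simp add: dist_sq_lam lam_axis inner_axis_axis)
  then have "dist (axis 1 1) (axis 2 1 :: real ^ 4) = sqrt 2" by (metis zero_le_dist real_sqrt_unique)
  then have D: "sqrt 2 \<le> dist a b" using far[OF axes axes] by metis
  have "a \<in> core \<or> b \<in> core" by (rule diametral_pair_core[OF ab(1,2) far D])
  then have "dist a b \<le> sqrt 2"
    using ab unfolding core_body_eq by (auto simp: dist_commute)
  then show "dist x y \<le> sqrt 2" using far[OF x y] by simp
  assume "dist x y = sqrt 2"
  then show "x \<in> core \<or> y \<in> core"
    using diametral_pair_core[OF x y] far \<open>dist a b \<le> sqrt 2\<close> by (metis order.trans order_refl)
qed

section \<open>The regular simplex\<close>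

lemma image_eqI_surj:
  assumes "surj f" and "\<And>x. f x \<in> T \<longleftrightarrow> x \<in> S"
  shows "f ` S = T"
proof (intro set_eqI iffI)
  fix z assume "z \<in> T"
  obtain x where "z = f x" using surjD[OF assms(1)] by blast
  with \<open>z \<in> T\<close> assms(2) show "z \<in> f ` S" by blast
qed (use assms(2) in auto)

text \<open>The last condition selects, in each face containing \<open>E\<close>, the part cut off by a sphere; in the
  coordinates of \<open>simplex_frame\<close> it says that \<open>p\<close> is not in the open unit ball. Stated through
  distances to the vertices, its symmetry is evident.\<close>
definition simplex_core :: "'a::metric_space set \<Rightarrow> 'a \<Rightarrow> 'a set" where
  "simplex_core S E = {p. (\<forall>X\<in>insert E S. dist p X \<le> 1) \<and>
     (\<exists>X\<in>S. \<exists>Y\<in>S. X \<noteq> Y \<and> dist p X = 1 \<and> dist p Y = 1) \<and>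
     (\<Sum>X\<in>S. 1 - (dist p X)\<^sup>2) - 1 \<le> (sqrt 5 - 1) * (1 - (dist p E)\<^sup>2)}"

lemma simplex_core_image:
  assumes "surj f" and iso: "\<And>x y. dist (f x) (f y) = dist x y"
  shows "f ` simplex_core S E = simplex_core (f ` S) (f E)"
proof -
  have inj: "inj f" by (metis dist_eq_0_iff injI iso)
  have "f p \<in> simplex_core (f ` S) (f E) \<longleftrightarrow> p \<in> simplex_core S E" for p
    unfolding simplex_core_def
    by (simp add: iso inj_eq[OF inj] sum.reindex[OF inj_on_subset[OF inj subset_UNIV]] o_def)
  then show ?thesis by (rule image_eqI_surj[OF assms(1)])
qed

lemma simplex_core_subset_two_skeleton:
  assumes "card (insert E S) = 5" "E \<notin> S"
  shows "simplex_core S E \<subseteq> two_skeleton (insert E S)"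
proof
  fix p assume p: "p \<in> simplex_core S E"
  then obtain X Y where XY: "X \<in> S" "Y \<in> S" "X \<noteq> Y" "dist p X = 1" "dist p Y = 1"
    unfolding simplex_core_def by blast
  \<comment> \<open>Points at distance \<open>1\<close> from \<open>X\<close> and \<open>Y\<close>
    belong to the face of the other three vertices, among them \<open>E\<close>.\<close>
  define T where "T = insert E S - {X, Y}"
  have "card T = 3" unfolding T_def using assms XY by (subst card_Diff_subset) auto
  moreover have "T \<subseteq> insert E S" by (auto simp: T_def)
  moreover have "p \<in> reuleaux_face (insert E S) T"
    using p XY unfolding reuleaux_face_def simplex_core_def T_def
    by (auto simp: mem_unit_ball_inter dist_commute)
  ultimately show "p \<in> two_skeleton (insert E S)" unfolding two_skeleton_def by blast
qed

lemma inner_unit_distances: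
  assumes "dist X E = 1" "dist Y E = 1" "dist X Y = (1::real)"
  shows "(X - E) \<bullet> (Y - E) = 1 / 2"
proof -
  have "(dist X Y)\<^sup>2 = (norm ((X - E) + (- 1) *\<^sub>R (Y - E)))\<^sup>2" by (simp add: dist_norm)
  then show ?thesis using assms unfolding norm_add_scaleR_sq by (simp add: dist_norm)
qed

text \<open>There is a unique such frame: \<open>F 0\<close> lies on the axis through \<open>E\<close>, beyond the opposite facet, where
  \<open>A\<close>, \<open>B\<close>, \<open>C\<close>, \<open>D\<close> are seen under right angles. This determines \<open>t\<close>.\<close>
lemma simplex_frame:
  fixes A B C D E :: "real ^ 4"
  assumes d: "dist A B = 1" "dist A C = 1" "dist A D = 1" "dist B C = 1" "dist B D = 1" "dist C D = 1"
    "dist A E = 1" "dist B E = 1" "dist C E = 1" "dist D E = 1"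
  obtains F :: "real ^ 4 \<Rightarrow> real ^ 4"
  where "surj F" "\<And>x y. dist (F x) (F y) = dist x y / sqrt 2"
    "F (axis 1 1) = A" "F (axis 2 1) = B" "F (axis 3 1) = C" "F (axis 4 1) = D" "F apex = E"
proof -
  define a b c e where "a = A - E" and "b = B - E" and "c = C - E" and "e = D - E"
  have n: "a \<bullet> a = 1" "b \<bullet> b = 1" "c \<bullet> c = 1" "e \<bullet> e = 1"
    using d by (simp_all add: a_def b_def c_def e_def norm_eq_1[symmetric] dist_norm)
  have i: "a \<bullet> b = 1 / 2" "a \<bullet> c = 1 / 2" "a \<bullet> e = 1 / 2" "b \<bullet> c = 1 / 2" "b \<bullet> e = 1 / 2" "c \<bullet> e = 1 / 2"
    unfolding a_def b_def c_def e_def using d by (simp_all add: inner_unit_distances)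
  then have i': "b \<bullet> a = 1 / 2" "c \<bullet> a = 1 / 2" "e \<bullet> a = 1 / 2" "c \<bullet> b = 1 / 2" "e \<bullet> b = 1 / 2" "e \<bullet> c = 1 / 2"
    by (simp_all add: inner_commute)
  define s where "s = a + b + c + e"
  have s: "a \<bullet> s = 5 / 2" "b \<bullet> s = 5 / 2" "c \<bullet> s = 5 / 2" "e \<bullet> s = 5 / 2" "s \<bullet> s = 10"
    by (simp_all add: s_def inner_add n i i')
  \<comment> \<open>The larger root of the equation that makes \<open>f1\<close> to
    \<open>f4\<close> orthogonal; the centroid of the facet opposite \<open>E\<close> corresponds to
    \<open>1 / 4 < t\<close>.\<close>
  define t :: real where "t = (5 + sqrt 5) / 20"
  have t: "1 / 2 - 5 * t + 10 * t\<^sup>2 = 0" by (simp add: t_def power2_eq_square field_simps)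
  define f1 f2 f3 f4 where "f1 = a - t *\<^sub>R s" and "f2 = b - t *\<^sub>R s" and "f3 = c - t *\<^sub>R s" and "f4 = e - t *\<^sub>R s"
  have fo: "(x - t *\<^sub>R s) \<bullet> (y - t *\<^sub>R s) = x \<bullet> y - 1 / 2" if "x \<bullet> s = 5 / 2" "y \<bullet> s = 5 / 2" for x y
  proof -
    have sy: "s \<bullet> y = 5 / 2" using that(2) by (simp only: inner_commute)
    have "(x - t *\<^sub>R s) \<bullet> (y - t *\<^sub>R s) = x \<bullet> y - t * (x \<bullet> s) - t * (s \<bullet> y) + t\<^sup>2 * (s \<bullet> s)"
      by (simp add: inner_diff power2_eq_square algebra_simps)
    also have "\<dots> = x \<bullet> y - 5 * t + 10 * t\<^sup>2" unfolding that(1) sy s(5) by simp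
    finally have "(x - t *\<^sub>R s) \<bullet> (y - t *\<^sub>R s) = x \<bullet> y - 5 * t + 10 * t\<^sup>2" .
    then show ?thesis using t by simp
  qed
  have f: "f1 \<bullet> f1 = 1 / 2" "f2 \<bullet> f2 = 1 / 2" "f3 \<bullet> f3 = 1 / 2" "f4 \<bullet> f4 = 1 / 2"
    "f1 \<bullet> f2 = 0" "f1 \<bullet> f3 = 0" "f1 \<bullet> f4 = 0" "f2 \<bullet> f3 = 0" "f2 \<bullet> f4 = 0" "f3 \<bullet> f4 = 0"
    "f2 \<bullet> f1 = 0" "f3 \<bullet> f1 = 0" "f4 \<bullet> f1 = 0" "f3 \<bullet> f2 = 0" "f4 \<bullet> f2 = 0" "f4 \<bullet> f3 = 0"
    unfolding f1_def f2_def f3_def f4_def by (simp_all add: fo s n i i')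
  define L where "L x = x$1 *\<^sub>R f1 + x$2 *\<^sub>R f2 + x$3 *\<^sub>R f3 + x$4 *\<^sub>R f4" for x :: "real ^ 4"
  have lin: "linear L" by (rule linearI) (simp_all add: L_def algebra_simps)
  have "(norm (L x))\<^sup>2 = (norm x)\<^sup>2 / 2" for x
    unfolding norm_real4[of x] unfolding power2_norm_eq_inner L_def
    by (simp add: inner_add f power2_eq_square)
  then have "norm (L x) = sqrt ((norm x)\<^sup>2 / 2)" for x by (metis norm_ge_zero real_sqrt_unique)
  then have nL: "norm (L x) = norm x / sqrt 2" for x by (simp add: real_sqrt_divide)
  have "inj L"
  proof (rule injI)
    fix x y assume "L x = L y"
    then have "L (x - y) = 0" by (simp add: linear_diff[OF lin])
    then show "x = y" using nL[of "x - y"] by simp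
  qed
  then have surj: "surj L" using lin by (simp add: linear_injective_imp_surjective)
  define F where "F x = E + t *\<^sub>R s + L x" for x
  show ?thesis
  proof (rule that[of F])
    show "surj F"
    proof (rule surjI)
      show "F (inv L (y - (E + t *\<^sub>R s))) = y" for y by (simp add: F_def surj_f_inv_f[OF surj])
    qed
    show "dist (F x) (F y) = dist x y / sqrt 2" for x y
      using nL[of "x - y"] by (simp add: F_def dist_norm linear_diff[OF lin])
    have "L (axis 1 1) = f1" "L (axis 2 1) = f2" "L (axis 3 1) = f3" "L (axis 4 1) = f4"
      by (simp_all add: L_def axis_def)
    then show "F (axis 1 1) = A" "F (axis 2 1) = B" "F (axis 3 1) = C" "F (axis 4 1) = D"
      by (simp_all add: F_def f1_def f2_def f3_def f4_def a_def b_def c_def e_def)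
    have "L apex = (phi / 2) *\<^sub>R (f1 + f2 + f3 + f4)"
      by (simp add: L_def apex_def scaleR_add_right)
    also have "f1 + f2 + f3 + f4 = (1 - 4 * t) *\<^sub>R s"
    proof -
      have "(a - v) + (b - v) + (c - v) + (e - v) = s - (v + v + v + v)" for v
        by (simp add: s_def)
      then have "f1 + f2 + f3 + f4 = s - (t + t + t + t) *\<^sub>R s"
        unfolding f1_def f2_def f3_def f4_def scaleR_left_distrib .
      then show ?thesis by (simp add: scaleR_left_diff_distrib)
    qed
    finally have "F apex = E + (t + phi / 2 * (1 - 4 * t)) *\<^sub>R s"
      by (simp add: F_def algebra_simps)
    also have "t + phi / 2 * (1 - 4 * t) = 0" by (simp add: t_def phi_def field_simps)
    finally show "F apex = E" by simp
  qed
qed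

lemma simplex_core_eq_image:
  fixes F :: "real ^ 4 \<Rightarrow> real ^ 4"
  assumes F: "surj F" "\<And>x y. dist (F x) (F y) = dist x y / sqrt 2"
  shows "simplex_core (range (\<lambda>i. F (axis i 1))) (F apex) = F ` core"
proof -
  have inj: "inj F" by (rule injI) (metis F(2) dist_eq_0_iff divide_eq_0_iff real_sqrt_eq_zero_cancel_iff zero_neq_numeral)
  have sq: "1 - (dist (F x) (F y))\<^sup>2 = x \<bullet> y - lam x - lam y" for x y
    using dist_sq_lam[of x y] unfolding F(2) power_divide by simp argo
  have le1: "dist (F x) (F y) \<le> 1 \<longleftrightarrow> lam x + lam y \<le> x \<bullet> y" for x y
    by (simp add: F(2) dist_le_sqrt2_iff[symmetric])
  have eq1: "dist (F x) (F y) = 1 \<longleftrightarrow> lam x + lam y = x \<bullet> y" for x y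
  proof -
    have "dist (F x) (F y) = 1 \<longleftrightarrow> (dist (F x) (F y))\<^sup>2 = 1"
      using zero_le_dist[of "F x" "F y"] unfolding power2_eq_1_iff by linarith
    then show ?thesis using sq[of x y] by argo
  qed
  have injV: "inj (\<lambda>i. F (axis i 1))"
  proof (rule injI)
    fix i j :: 4 assume "F (axis i 1) = F (axis j 1)"
    then have "axis i 1 = (axis j 1 :: real ^ 4)" using inj by (simp add: inj_eq)
    then show "i = j" by (simp add: axis_eq_axis)
  qed
  have "F x \<in> simplex_core (range (\<lambda>i. F (axis i 1))) (F apex) \<longleftrightarrow> x \<in> core" for x
  proof -
    have sumV: "(\<Sum>X\<in>range (\<lambda>i. F (axis i 1)). 1 - (dist (F x) X)\<^sup>2)
        = x$1 + x$2 + x$3 + x$4 - 4 * lam x"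
      by (simp add: sum.reindex[OF injV] sq lam_axis inner_axis sum_4)
    have ap: "x \<bullet> apex = phi / 2 * (x$1 + x$2 + x$3 + x$4)"
      by (simp add: inner_real4 apex_def algebra_simps)
    have s5: "sqrt 5 < 5" by (rule real_less_lsqrt) auto
    have "(sqrt 5 - 1) * (x \<bullet> apex - lam x - lam apex)
        = ((sqrt 5 - 1) * phi / 2) * (x$1 + x$2 + x$3 + x$4 - 1) - (sqrt 5 - 1) * lam x"
      unfolding ap lam_apex by (simp add: field_simps)
    \<comment> \<open>The factor \<open>sqrt 5 - 1\<close> in \<open>simplex_core\<close> is
      \<open>2 / phi\<close>, so the coordinate sums cancel and only a multiple of
      \<open>lam x\<close> is left.\<close>
    also have "(sqrt 5 - 1) * phi / 2 = 1" by (simp add: phi_def field_simps)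
    finally have e: "(sqrt 5 - 1) * (x \<bullet> apex - lam x - lam apex)
        = (x$1 + x$2 + x$3 + x$4 - 1) - (sqrt 5 - 1) * lam x"
      by simp
    have "(x$1 + x$2 + x$3 + x$4 - 4 * lam x) - 1 \<le> (sqrt 5 - 1) * (x \<bullet> apex - lam x - lam apex)
        \<longleftrightarrow> 0 \<le> (5 - sqrt 5) * lam x"
      unfolding e unfolding left_diff_distrib by argo
    also have "\<dots> \<longleftrightarrow> 0 \<le> lam x" using s5 by (simp add: zero_le_mult_iff)
    finally have cond: "(x$1 + x$2 + x$3 + x$4 - 4 * lam x) - 1 \<le> (sqrt 5 - 1) * (x \<bullet> apex - lam x - lam apex)
        \<longleftrightarrow> 0 \<le> lam x" .
    have axle: "dist (F x) (F (axis i 1)) \<le> 1 \<longleftrightarrow> lam x \<le> x $ i" for i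
      by (simp add: le1 lam_axis inner_axis)
    have axeq: "dist (F x) (F (axis i 1)) = 1 \<longleftrightarrow> x $ i = lam x" for i
      by (auto simp: eq1 lam_axis inner_axis)
    have "F x \<in> simplex_core (range (\<lambda>i. F (axis i 1))) (F apex) \<longleftrightarrow>
       lam x + lam apex \<le> x \<bullet> apex \<and> (\<forall>i. lam x \<le> x $ i) \<and>
       (\<exists>i j. i \<noteq> j \<and> x $ i = lam x \<and> x $ j = lam x) \<and> 0 \<le> lam x"
      unfolding simplex_core_def
      unfolding mem_Collect_eq sumV sq cond by (auto simp: le1[of x apex] axle axeq inj_eq[OF injV])
    \<comment> \<open>Points of \<open>core\<close> satisfy the bound for \<open>apex\<close> by
      \<open>region_inner\<close>, since \<open>apex\<close> is in \<open>region\<close>.\<close>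
    also have "\<dots> \<longleftrightarrow> x \<in> core"
      using region_inner(1)[of x apex] apex_core core_subset_region
      by (auto simp: core_def region_def)
    finally show ?thesis .
  qed
  then show ?thesis by (rule image_eqI_surj[OF F(1), symmetric])
qed

lemma unit_ball_inter_image_core:
  fixes F :: "real ^ 4 \<Rightarrow> real ^ 4"
  assumes F: "surj F" "\<And>x y. dist (F x) (F y) = dist x y / sqrt 2"
  shows "unit_ball_inter (F ` core) = F ` core_body"
proof -
  have "F x \<in> unit_ball_inter (F ` core) \<longleftrightarrow> x \<in> core_body" for x
    by (auto simp: mem_unit_ball_inter core_body_eq F(2))
  then show ?thesis by (rule image_eqI_surj[OF F(1), symmetric])
qed

section \<open>The body for the given simplex\<close>

theorem theorem1p1:
  fixes A B C D E :: "real ^ 4"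
  assumes "distinct [A, B, C, D, E]"
    and "regular_simplex_vertices 4 1 {A, B, C, D, E}"
  shows "\<exists>M0 :: (real ^ 4) set.
    {A, B, C, D, E} \<subseteq> M0 \<and>
    M0 \<subseteq> two_skeleton {A, B, C, D, E} \<and>
    (let M = unit_ball_inter M0 in
       constant_width_body M \<and>
       (\<forall>f. euclidean_isometry f \<and> f E = E \<and> f ` {A, B, C, D} = {A, B, C, D} \<longrightarrow>
          f ` M0 = M0 \<and> f ` M = M) \<and>
       M0 \<subseteq> frontier M \<and>
       (\<forall>x \<in> frontier M - M0. smooth_point M x) \<and>
       (\<forall>p q. diameter_endpoints M p q \<longrightarrow> p \<in> M0 \<or> q \<in> M0))"
proof -
  have d: "dist X Y = 1" if "X \<in> {A, B, C, D, E}" "Y \<in> {A, B, C, D, E}" "X \<noteq> Y" for X Y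
    using assms(2) that unfolding regular_simplex_vertices_def by blast
  obtain F :: "real ^ 4 \<Rightarrow> real ^ 4" where F: "surj F" "\<And>x y. dist (F x) (F y) = dist x y / sqrt 2"
    and FV: "F (axis 1 1) = A" "F (axis 2 1) = B" "F (axis 3 1) = C" "F (axis 4 1) = D" "F apex = E"
    by (rule simplex_frame[of A B C D E]) (use assms(1) in \<open>auto intro!: d\<close>)
  define S where "S = {A, B, C, D}"
  define M0 where "M0 = simplex_core S E"
  define M where "M = unit_ball_inter M0"
  have V: "{A, B, C, D, E} = insert E S" unfolding S_def by blast
  have rng: "range (\<lambda>i. F (axis i 1)) = S"
    unfolding S_def UNIV_4 by (simp add: FV)
  have M0_eq: "M0 = F ` core"
    using simplex_core_eq_image[OF F] unfolding rng FV M0_def .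
  have M_eq: "M = F ` core_body"
    unfolding M_def M0_eq by (rule unit_ball_inter_image_core[OF F])
  have M0_M: "M0 \<subseteq> M"
    unfolding M_eq M0_eq using core_subset_region region_subset_core_body by blast
  have le1: "dist p q \<le> 1" if "p \<in> M" "q \<in> M" for p q
    using that core_body_dist(1) unfolding M_eq by (auto simp: F(2))
  have eq1: "p \<in> M0 \<or> q \<in> M0" if pq: "p \<in> M" "q \<in> M" "dist p q = 1" for p q
  proof -
    obtain x y where xy: "p = F x" "q = F y" "x \<in> core_body" "y \<in> core_body"
      using pq(1,2) unfolding M_eq by blast
    then have "dist x y = sqrt 2" using pq(3) F(2)[of x y] by simp
    then show ?thesis using core_body_dist(2)[OF xy(3,4)] xy(1,2) unfolding M0_eq by blast
  qed
  have MM: "unit_ball_inter M = M"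
    unfolding M_def by (rule unit_ball_inter_self_dual) (use M0_M le1 in \<open>auto simp: M_def\<close>)
  have VM0: "insert E S \<subseteq> M0"
    unfolding M0_eq rng[symmetric] FV(5)[symmetric] using apex_core axis_core by auto
  have AB: "A \<in> M" "B \<in> M" "A \<noteq> B" using VM0 M0_M assms(1) by (auto simp: S_def)
  have skel: "M0 \<subseteq> two_skeleton (insert E S)"
    unfolding M0_def
    by (rule simplex_core_subset_two_skeleton) (use assms(1) in \<open>auto simp: S_def\<close>)
  have touch: "\<exists>W\<in>S. dist p W = 1" if "p \<in> M0" for p
    using that unfolding M0_def simplex_core_def by blast
  have SM: "S \<subseteq> M" using VM0 M0_M by blast
  have sym: "f ` M0 = M0 \<and> f ` M = M"
    if f: "euclidean_isometry f" "f E = E" "f ` S = S" for f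
  proof -
    have iso: "dist (f x) (f y) = dist x y" for x y using f by (simp add: euclidean_isometry_def)
    have sf: "surj f" by (rule dist_isometry_imp_surj[OF iso])
    have "f ` M0 = M0" unfolding M0_def simplex_core_image[OF sf iso] f(2,3) ..
    moreover have "f ` M = unit_ball_inter (f ` M0)"
      unfolding M_def by (rule unit_ball_inter_image[OF sf iso])
    ultimately show ?thesis by (simp add: M_def)
  qed
  have front: "M0 \<subseteq> frontier M"
  proof
    fix p assume p: "p \<in> M0"
    obtain W where W: "W \<in> S" "dist p W = 1" using touch[OF p] by blast
    have "p \<notin> interior M" by (rule dist_eq_1_notin_interior[OF MM _ W(2)]) (use W SM in blast)
    then show "p \<in> frontier M" using p M0_M closure_subset by (auto simp: frontier_def)
  qed
  have smooth: "smooth_point M x" if x: "x \<in> frontier M" "x \<notin> M0" for x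
  proof (rule smooth_point_self_dual[OF MM _ _ SM x(1)])
    show "interior M \<noteq> {}" by (rule interior_self_dual_nonempty[OF MM AB])
    show "finite S" by (simp add: S_def)
    show "x \<notin> S" using x VM0 by blast
    have "closed M" using compact_unit_ball_inter[of M] MM AB(1) compact_imp_closed by auto
    then have xM: "x \<in> M" using x(1) frontier_subset_closed by blast
    \<comment> \<open>Since \<open>x\<close> is not in \<open>M0\<close>, a point opposite to it is,
      and \<open>M0\<close> is covered by the unit spheres about \<open>S\<close>.\<close>
    show "\<exists>W\<in>S. dist y W = 1" if "y \<in> M" "dist x y = 1" for y
      using eq1[OF xM that] x(2) touch by blast
  qed
  have diam: "p \<in> M0 \<or> q \<in> M0" if "diameter_endpoints M p q" for p q
  proof -
    have pq: "p \<in> M" "q \<in> M" "dist p q = diameter M" using that by (auto simp: diameter_endpoints_def)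
    \<comment> \<open>The distance between two vertices shows that the diameter is exactly
      \<open>1\<close>, so \<open>eq1\<close> applies to its endpoints.\<close>
    have "bounded M" using compact_unit_ball_inter[of M] MM AB(1) compact_imp_bounded by auto
    then have "dist A B \<le> diameter M" using AB diameter_bounded_bound by blast
    moreover have "dist A B = 1" using d AB(3) by simp
    ultimately have "dist p q = 1" using le1[OF pq(1,2)] pq(3) by simp
    then show ?thesis using eq1 pq by blast
  qed
  show ?thesis
    unfolding V Let_def
    by (rule exI[of _ M0], fold M_def S_def)
      (use VM0 skel constant_width_self_dual[OF MM AB] sym front smooth diam in blast)
qed

end
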